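(* For any integers $s$ and $d$ satisfying $1\le s\le d$, and any $\sigma>0$, the minimax rate of testing on $\Theta_{0,s}$ is equal to $\lambda=\big(\psi_\sigma^{\sqrt Q}(s,d)\big)^{1/2}$. For any $0<q<2$, and any $r,\sigma>0$, the minimax rate of testing on $\Theta_{q,r}$ is equal to $\lambda=\big(\psi_{\sigma,q}^{\sqrt Q}(r,d)\big)^{1/2}$.
   Context: Model: one observes $y_j=\theta_j+\sigma\xi_j$, $j=1,\dots,d$ ($d\ge1$ an integer), where $\theta=(\theta_1,\dots,\theta_d)\in\mathbb R^d$ is an unknown vector of parameters, $\xi_j$ are i.i.d. standard normal random variables and $\sigma>0$ is the noise level. $\mathbf P_\theta$ is the probability measure of the vector of observations $(y_1,\dots,y_d)$. $\|\theta\|_0$ is the number of non-zero components of $\theta$, and $\|\theta\|_q=\big(\sum_{i=1}^d|\theta_i|^q\big)^{1/q}$ for $q>0$. For $q\ge0$, $u>0$, $B_q(u)=\{\theta\in\mathbb R^d:\|\theta\|_q\le u\}$, and for $\delta>0$, $$\Theta_{q,u}(\delta)=\{\theta\in B_q(u):\|\theta\|_2\ge\delta\}.$$ For testing the hypothesis $\mathbf H_0:\theta=0$ against the alternative $\mathbf H_1:\theta\in\Theta_{q,u}(\delta)$, the minimax risk of testing is $$\mathcal R_{q,u}(\delta)=\inf_\Delta\Big\{\mathbf P_0(\Delta=1)+\sup_{\theta\in\Theta_{q,u}(\delta)}\mathbf P_\theta(\Delta=0)\Big\},$$ where $\inf_\Delta$ is the infimum over all $\{0,1\}$-valued statistics.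 The minimax rate of testing on $\Theta_{q,u}$ is defined as $\lambda>0$ for which the following two facts hold: (i) for any $\varepsilon\in(0,1)$ there exists $A_\varepsilon>0$ such that, for all $A>A_\varepsilon$, $\mathcal R_{q,u}(A\lambda)\le\varepsilon$; (ii) for any $\varepsilon\in(0,1)$ there exists $a_\varepsilon>0$ such that, for all $0<A<a_\varepsilon$, $\mathcal R_{q,u}(A\lambda)\ge1-\varepsilon$. This is a non-asymptotic minimax rate of testing, as opposed to the classical asymptotic definition. Rates: $$\psi_\sigma^{\sqrt Q}(s,d)=\begin{cases}\sigma^2s\log(1+d/s^2)&\text{if } s<\sqrt d,\\ \sigma^2\sqrt d&\text{if } s\ge\sqrt d.\end{cases}$$ For any $r,\sigma,q>0$ and any integer $d\ge1$, the integer $m$ is defined by $$m=\max\{s\ge 1:\ \sigma^2\log(1+d/s^2)\le r^2s^{-2/q},\ s\in\mathbb N\}$$ if the set $\{s\ge 1:\ \sigma^2\log(1+d/s^2)\le r^2s^{-2/q},\ s\in\mathbb N\}$ is non-empty, and $m=0$ if this set is empty. For $0<q<2$, $$\psi_{\sigma,q}^{\sqrt Q}(r,d)=\begin{cases}\sigma^2\sqrt d&\text{if } m>\sqrt d,\\ \sigma^2m\log(1+d/m^2)&\text{if } 1\le m\le\sqrt d,\\ r^2&\text{if } m=0.\end{cases}$$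
   Formalization: The set defining m is infinite for every 1<q<2, and for q=1 if r^2 ≥ σ^2 d, so its maximum does not exist; there m is taken as the length (possibly infinite) of the longest initial segment {1,…,m} contained in the set. Elsewhere m is as stated. *)

theory Defs
  imports "HOL-Probability.Probability" "HOL-Library.Extended_Nat"
begin

text \<open>
  Vectors of \<open>R\<^sup>d\<close> are the extensional functions on \<open>{1..d}\<close>, because the dimension
  has to vary inside the statement.
\<close>

definition vec_space :: "nat \<Rightarrow> (nat \<Rightarrow> real) set" where
  "vec_space d = ({1..d} \<rightarrow>\<^sub>E UNIV)"

definition zero_vec :: "nat \<Rightarrow> nat \<Rightarrow> real" where
  "zero_vec d = (\<lambda>j\<in>{1..d}. 0)"

definition obs_space :: "nat \<Rightarrow> (nat \<Rightarrow> real) measure" where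
  "obs_space d = (\<Pi>\<^sub>M j\<in>{1..d}. borel)"

definition obs_law :: "nat \<Rightarrow> real \<Rightarrow> (nat \<Rightarrow> real) \<Rightarrow> (nat \<Rightarrow> real) measure" where
  "obs_law d \<sigma> \<theta> =
     distr (\<Pi>\<^sub>M j\<in>{1..d}. std_normal_distribution) (obs_space d)
       (\<lambda>\<xi>. \<lambda>j\<in>{1..d}. \<theta> j + \<sigma> * \<xi> j)"

definition lq_norm :: "nat \<Rightarrow> real \<Rightarrow> (nat \<Rightarrow> real) \<Rightarrow> real" where
  "lq_norm d q \<theta> =
     (if q = 0 then real (card {j\<in>{1..d}. \<theta> j \<noteq> 0})
      else (\<Sum>j\<in>{1..d}. \<bar>\<theta> j\<bar> powr q) powr (1 / q))"

definition lq_ball :: "nat \<Rightarrow> real \<Rightarrow> real \<Rightarrow> (nat \<Rightarrow> real) set" where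
  "lq_ball d q u = {\<theta> \<in> vec_space d. lq_norm d q \<theta> \<le> u}"

definition alternative_set :: "nat \<Rightarrow> real \<Rightarrow> real \<Rightarrow> real \<Rightarrow> (nat \<Rightarrow> real) set" where
  "alternative_set d q u \<delta> = {\<theta> \<in> lq_ball d q u. lq_norm d 2 \<theta> \<ge> \<delta>}"

definition tests :: "nat \<Rightarrow> ((nat \<Rightarrow> real) \<Rightarrow> nat) set" where
  "tests d = measurable (obs_space d) (count_space {0, 1})"

text \<open>
  The risk takes values in \<^typ>\<open>ennreal\<close>, so that the supremum over an empty alternative is 0
  (on the type of reals it would be unspecified).
\<close>

definition testing_risk :: "nat \<Rightarrow> real \<Rightarrow> real \<Rightarrow> real \<Rightarrow> real \<Rightarrow> ennreal" where
  "testing_risk d \<sigma> q u \<delta> =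
     (INF \<Delta>\<in>tests d.
        emeasure (obs_law d \<sigma> (zero_vec d)) {y \<in> space (obs_space d). \<Delta> y = 1}
        + (SUP \<theta>\<in>alternative_set d q u \<delta>.
             emeasure (obs_law d \<sigma> \<theta>) {y \<in> space (obs_space d). \<Delta> y = 0}))"

text \<open>
  A non-asymptotic rate is a property of a family of testing problems: \<open>I\<close> is the set of
  admissible parameters, \<open>R i\<close> the risk as a function of the radius, \<open>rate i\<close> the claimed rate.
  The constants \<open>A\<^sub>0\<close> and \<open>a\<^sub>0\<close> depend on \<open>\<epsilon>\<close> only and not on the parameters. (If they could
  depend on \<open>i\<close>, every positive function would be a rate of testing for the problems below.)
\<close>

definition minimax_testing_rate ::
    "'i set \<Rightarrow> ('i \<Rightarrow> real \<Rightarrow> ennreal) \<Rightarrow> ('i \<Rightarrow> real) \<Rightarrow> bool" where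
  "minimax_testing_rate I R rate \<longleftrightarrow>
     (\<forall>i\<in>I. rate i > 0) \<and>
     (\<forall>\<epsilon>::real. 0 < \<epsilon> \<and> \<epsilon> < 1 \<longrightarrow>
        (\<exists>A\<^sub>0>0. \<forall>i\<in>I. \<forall>A>A\<^sub>0. R i (A * rate i) \<le> ennreal \<epsilon>)) \<and>
     (\<forall>\<epsilon>::real. 0 < \<epsilon> \<and> \<epsilon> < 1 \<longrightarrow>
        (\<exists>a\<^sub>0>0. \<forall>i\<in>I. \<forall>A. 0 < A \<and> A < a\<^sub>0 \<longrightarrow> R i (A * rate i) \<ge> ennreal (1 - \<epsilon>)))"

definition psi_sparse :: "real \<Rightarrow> nat \<Rightarrow> nat \<Rightarrow> real" where
  "psi_sparse \<sigma> s d =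
     (if real s < sqrt (real d) then \<sigma>\<^sup>2 * real s * ln (1 + real d / (real s)\<^sup>2)
      else \<sigma>\<^sup>2 * sqrt (real d))"

definition sparsity_levels :: "real \<Rightarrow> real \<Rightarrow> real \<Rightarrow> nat \<Rightarrow> nat set" where
  "sparsity_levels \<sigma> q r d =
     {s. s \<ge> 1 \<and> \<sigma>\<^sup>2 * ln (1 + real d / (real s)\<^sup>2) \<le> r\<^sup>2 * real s powr (- (2 / q))}"

text \<open>
  The number \<open>m\<close> is the maximum of the set of sparsity levels, and 0 if that set is empty.
  The maximum does not exist when the set is infinite. Writing the defining inequality as
  \<open>\<sigma>\<^sup>2 f(s) \<le> r\<^sup>2\<close> with \<open>f(s) = s powr (2/q) * ln (1 + d/s\<^sup>2)\<close>:

  \<^item> for \<open>q < 1\<close>, \<open>f\<close> increases to infinity and the set is finite;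
  \<^item> for \<open>q = 1\<close>, \<open>f\<close> increases to \<open>d\<close>, so the set is an initial segment, and it is
    all of \<open>{1..}\<close> iff \<open>r\<^sup>2 \<ge> \<sigma>\<^sup>2 d\<close>;
  \<^item> for \<open>1 < q < 2\<close>, \<open>f(s)\<close> tends to 0 and the set is infinite for every \<open>r\<close>, \<open>\<sigma>\<close>, \<open>d\<close>.

  If the set is infinite, \<open>m\<close> is by convention the length of its longest initial segment, the
  level up to which the inequality persists (infinite for \<open>q = 1\<close>, as it should be). For
  \<open>q \<le> 1\<close> the set is itself an initial segment, so this extends the definition by a maximum.
  Reading \<open>m\<close> as infinite for all \<open>1 < q < 2\<close> would give the rate \<open>\<sigma> d powr (1/4)\<close> even when
  \<open>r\<close>, which bounds the 2-norm on the ball, is much smaller.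
\<close>

definition effective_sparsity :: "real \<Rightarrow> real \<Rightarrow> real \<Rightarrow> nat \<Rightarrow> enat" where
  "effective_sparsity \<sigma> q r d =
     (let S = sparsity_levels \<sigma> q r d in
        if S = {} then 0
        else if finite S then enat (Max S)
        else (SUP s\<in>{s. {1..s} \<subseteq> S}. enat s))"

definition psi_ball :: "real \<Rightarrow> real \<Rightarrow> real \<Rightarrow> nat \<Rightarrow> real" where
  "psi_ball \<sigma> q r d =
     (case effective_sparsity \<sigma> q r d of
        \<infinity> \<Rightarrow> \<sigma>\<^sup>2 * sqrt (real d)
      | enat m \<Rightarrow>
          if real m > sqrt (real d) then \<sigma>\<^sup>2 * sqrt (real d)
          else if m \<ge> 1 then \<sigma>\<^sup>2 * real m * ln (1 + real d / (real m)\<^sup>2)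
          else r\<^sup>2)"

end

theory Submission
  imports Defs
begin

text \<open>
  Write \<open>L(s) = ln (1 + d/s\<^sup>2)\<close>.

  Lower bound. Split \<open>s * (d div s)\<close> coordinates into \<open>s\<close> blocks and put the value
  \<open>a \<le> A \<sigma> sqrt L(s)\<close>, \<open>A \<le> 1\<close>, on one uniformly chosen coordinate of each block. The second moment
  of the likelihood ratio of this mixture factorises over the blocks and equals
  \<open>(1 + (exp (a\<^sup>2/\<sigma>\<^sup>2) - 1) / (d div s))\<^bsup>s\<^esup> \<le> exp (2 A\<^sup>2)\<close>.

  Upper bound. For \<open>s \<le> sqrt d\<close> the test rejects for large values of the centred sum of
  \<open>max (\<bar>y\<^sub>j/\<sigma>\<bar> - 3 sqrt L(s)) 0\<close> squared. Under the null hypothesis the variance of this sum is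
  \<open>O(s\<^sup>2)\<close>. If at most \<open>s\<close> coordinates exceed \<open>\<sigma> sqrt L(s)\<close>, Chebyshev's inequality
  detects them as soon as their squares sum to a large multiple of \<open>\<sigma>\<^sup>2 s L(s)\<close>; the remaining
  coordinates can only increase the mean. Without the threshold this is the chi-square test, which
  gives \<open>\<sigma>\<^sup>2 sqrt d\<close>.

  On an \<open>l\<^sub>q\<close>-ball, the failure of the defining inequality at \<open>m + 1\<close> says that
  \<open>r\<^bsup>q\<^esup> < (m + 1) (\<sigma> sqrt L(m))\<^bsup>q\<^esup>\<close>. Hence at most \<open>m\<close> coordinates exceed \<open>\<sigma> sqrt L(m)\<close>, and the
  squares of the others sum to at most \<open>2 \<sigma>\<^sup>2 m L(m)\<close>, with constants that do not depend on \<open>q\<close>.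
\<close>

section \<open>Gaussian observations and likelihood ratios\<close>

abbreviation normal_law :: "real \<Rightarrow> real \<Rightarrow> real measure" where
  "normal_law \<mu> \<sigma> \<equiv> density lborel (\<lambda>x. ennreal (normal_density \<mu> \<sigma> x))"

lemma integrable_normal_law_iff:
  fixes f :: "real \<Rightarrow> real"
  assumes [measurable]: "f \<in> borel_measurable borel"
  shows "integrable (normal_law \<mu> \<sigma>) f \<longleftrightarrow> integrable lborel (\<lambda>x. normal_density \<mu> \<sigma> x * f x)"
  by (subst integrable_density) (auto simp: mult.commute)

lemma integral_normal_law:
  fixes f :: "real \<Rightarrow> real"
  assumes [measurable]: "f \<in> borel_measurable borel"
  shows "(\<integral>x. f x \<partial>normal_law \<mu> \<sigma>) = (\<integral>x. normal_density \<mu> \<sigma> x * f x \<partial>lborel)"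
  by (subst integral_density) (auto simp: mult.commute)

lemma distr_std_normal_affine:
  assumes "\<sigma> > 0"
  shows "distr std_normal_distribution borel (\<lambda>x. \<mu> + \<sigma> * x) = normal_law \<mu> \<sigma>"
proof -
  interpret prob_space "std_normal_distribution" by (rule prob_space_normal_density) simp
  have "distributed std_normal_distribution lborel (\<lambda>x. x) std_normal_density"
    unfolding distributed_def
    by (auto intro!: measure_eqI simp: emeasure_distr)
  from normal_density_affine[OF this, of \<sigma> \<mu>] assms
  have "distr std_normal_distribution lborel (\<lambda>x. \<mu> + \<sigma> * x) = normal_law \<mu> \<sigma>"
    by (auto simp: distributed_def)
  moreover have "distr std_normal_distribution lborel (\<lambda>x. \<mu> + \<sigma> * x)
      = distr std_normal_distribution borel (\<lambda>x. \<mu> + \<sigma> * x)"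
    by (rule distr_cong) auto
  ultimately show ?thesis by simp
qed

lemma sets_PiM_normal [measurable_cong]: "sets (\<Pi>\<^sub>M j\<in>I. normal_law (\<mu> j) \<sigma>) = sets (\<Pi>\<^sub>M j\<in>I. borel)"
  by (rule sets_PiM_cong) auto

text \<open>Boxes determine a product measure, and the noise map acts coordinatewise, so it pulls a
  box back to a box. This replaces the pushforward by a product on which densities can be computed
  factor by factor.\<close>

lemma obs_law_eq_PiM:
  assumes "\<sigma> > 0"
  shows "obs_law d \<sigma> \<theta> = (\<Pi>\<^sub>M j\<in>{1..d}. normal_law (\<theta> j) \<sigma>)"
proof -
  interpret N: product_prob_space "\<lambda>j::nat. std_normal_distribution" "{1..d}"
    by (intro product_prob_spaceI prob_space_normal_density) simp
  interpret P: product_prob_space "\<lambda>j. normal_law (\<theta> j) \<sigma>" "{1..d}"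
    using assms by (intro product_prob_spaceI prob_space_normal_density)
  have shift: "(\<lambda>\<xi>. \<lambda>j\<in>{1..d}. \<theta> j + \<sigma> * \<xi> j)
      \<in> measurable (\<Pi>\<^sub>M j\<in>{1..d}. std_normal_distribution) (obs_space d)"
    unfolding obs_space_def by measurable
  show ?thesis
  proof (rule P.PiM_eqI)
    show "sets (obs_law d \<sigma> \<theta>) = sets (\<Pi>\<^sub>M j\<in>{1..d}. normal_law (\<theta> j) \<sigma>)"
      by (simp add: obs_law_def obs_space_def sets_PiM_normal)
    fix A assume A: "\<And>i. i \<in> {1..d} \<Longrightarrow> A i \<in> sets (normal_law (\<theta> i) \<sigma>)"
    then have A': "\<And>i. i \<in> {1..d} \<Longrightarrow> A i \<in> sets borel" by auto
    have "emeasure (obs_law d \<sigma> \<theta>) (Pi\<^sub>E {1..d} A) = emeasure (\<Pi>\<^sub>M j\<in>{1..d}. std_normal_distribution)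
        ((\<lambda>\<xi>. \<lambda>j\<in>{1..d}. \<theta> j + \<sigma> * \<xi> j) -` (Pi\<^sub>E {1..d} A) \<inter> space (\<Pi>\<^sub>M j\<in>{1..d}. std_normal_distribution))"
      unfolding obs_law_def using A'
      by (intro emeasure_distr shift) (auto simp: obs_space_def intro!: sets_PiM_I_finite)
    also have "\<dots> = emeasure (\<Pi>\<^sub>M j\<in>{1..d}. std_normal_distribution)
        (\<Pi>\<^sub>E j\<in>{1..d}. (\<lambda>x. \<theta> j + \<sigma> * x) -` A j)"
      by (rule arg_cong[where f="emeasure _"]) (auto simp: space_PiM PiE_iff)
    also have "\<dots> = (\<Prod>j\<in>{1..d}. emeasure std_normal_distribution ((\<lambda>x. \<theta> j + \<sigma> * x) -` A j))"
    proof (rule N.emeasure_PiM)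
      fix i assume "i \<in> {1..d}"
      from A'[OF this] have "(\<lambda>x. \<theta> i + \<sigma> * x) -` A i \<inter> space borel \<in> sets borel"
        by (intro measurable_sets[of _ borel borel]) auto
      then show "(\<lambda>x. \<theta> i + \<sigma> * x) -` A i \<in> sets std_normal_distribution" by simp
    qed simp
    also have "\<dots> = (\<Prod>j\<in>{1..d}. emeasure (normal_law (\<theta> j) \<sigma>) (A j))"
    proof (rule prod.cong)
      fix j assume "j \<in> {1..d}"
      from A'[OF this] show "emeasure std_normal_distribution ((\<lambda>x. \<theta> j + \<sigma> * x) -` A j)
          = emeasure (normal_law (\<theta> j) \<sigma>) (A j)"
        unfolding distr_std_normal_affine[OF assms, symmetric]
        by (subst emeasure_distr) auto
    qed simp
    finally show "emeasure (obs_law d \<sigma> \<theta>) (Pi\<^sub>E {1..d} A)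
        = (\<Prod>j\<in>{1..d}. emeasure (normal_law (\<theta> j) \<sigma>) (A j))" .
  qed simp
qed

lemma prob_space_obs_law: "\<sigma> > 0 \<Longrightarrow> prob_space (obs_law d \<sigma> \<theta>)"
  unfolding obs_law_eq_PiM by (intro prob_space_PiM prob_space_normal_density)

lemma sets_obs_law [simp, measurable_cong]: "sets (obs_law d \<sigma> \<theta>) = sets (obs_space d)"
  by (simp add: obs_law_def)

lemma space_obs_law [simp]: "space (obs_law d \<sigma> \<theta>) = space (obs_space d)"
  by (simp add: obs_law_def)

text \<open>The likelihood ratio of the normal law with mean \<open>t\<close> and deviation
  \<open>\<sigma>\<close> against the centred one.\<close>

definition normal_lr :: "real \<Rightarrow> real \<Rightarrow> real \<Rightarrow> real" where
  "normal_lr \<sigma> t x = exp ((t * x - t\<^sup>2 / 2) / \<sigma>\<^sup>2)"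

lemma normal_lr_measurable [measurable]: "normal_lr \<sigma> t \<in> borel_measurable borel"
  unfolding normal_lr_def by measurable

lemma normal_lr_pos: "normal_lr \<sigma> t x > 0" by (simp add: normal_lr_def)

lemma normal_density_shift:
  assumes "\<sigma> > 0"
  shows "normal_density t \<sigma> x = normal_density 0 \<sigma> x * normal_lr \<sigma> t x"
proof -
  have "- (x - t)\<^sup>2 / (2 * \<sigma>\<^sup>2) = - (x - 0)\<^sup>2 / (2 * \<sigma>\<^sup>2) + (t * x - t\<^sup>2 / 2) / \<sigma>\<^sup>2"
    using assms by (simp add: field_simps power2_eq_square)
  then show ?thesis
    unfolding normal_density_def normal_lr_def by (simp only: exp_add mult.assoc)
qed

text \<open>Completing the square. The product is again a likelihood ratio, for the shift
  \<open>t + u\<close>, up to a constant factor; integrating it therefore needs only the total mass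
  1.\<close>

lemma normal_lr_mult: 
  assumes "\<sigma> > 0"
  shows "normal_lr \<sigma> t x * normal_lr \<sigma> u x = exp (t * u / \<sigma>\<^sup>2) * normal_lr \<sigma> (t + u) x"
proof -
  have "(t * x - t\<^sup>2 / 2) / \<sigma>\<^sup>2 + (u * x - u\<^sup>2 / 2) / \<sigma>\<^sup>2
      = t * u / \<sigma>\<^sup>2 + ((t + u) * x - (t + u)\<^sup>2 / 2) / \<sigma>\<^sup>2"
    using assms by (simp add: field_simps power2_eq_square)
  then show ?thesis
    unfolding normal_lr_def by (simp only: exp_add[symmetric])
qed

lemma has_bochner_integral_normal_lr:
  assumes "\<sigma> > 0"
  shows "has_bochner_integral (normal_law 0 \<sigma>) (normal_lr \<sigma> t) 1"
proof -
  have "has_bochner_integral lborel (normal_density t \<sigma>) 1"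
    using assms by (simp add: has_bochner_integral_iff)
  then show ?thesis
    by (simp add: has_bochner_integral_iff integrable_normal_law_iff integral_normal_law
        flip: normal_density_shift[OF assms])
qed

lemma has_bochner_integral_normal_lr_mult:
  assumes "\<sigma> > 0"
  shows "has_bochner_integral (normal_law 0 \<sigma>) (\<lambda>x. normal_lr \<sigma> t x * normal_lr \<sigma> u x) (exp (t * u / \<sigma>\<^sup>2))"
proof -
  have "has_bochner_integral (normal_law 0 \<sigma>)
      (\<lambda>x. exp (t * u / \<sigma>\<^sup>2) * normal_lr \<sigma> (t + u) x) (exp (t * u / \<sigma>\<^sup>2) * 1)"
    by (intro has_bochner_integral_mult_right has_bochner_integral_normal_lr assms)
  then show ?thesis
    by (simp add: normal_lr_mult[OF assms])
qed

definition obs_lr :: "nat \<Rightarrow> real \<Rightarrow> (nat \<Rightarrow> real) \<Rightarrow> (nat \<Rightarrow> real) \<Rightarrow> real" where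
  "obs_lr d \<sigma> \<theta> y = (\<Prod>j\<in>{1..d}. normal_lr \<sigma> (\<theta> j) (y j))"

lemma obs_lr_measurable [measurable]: "obs_lr d \<sigma> \<theta> \<in> borel_measurable (obs_space d)"
  unfolding obs_lr_def obs_space_def by measurable

lemma obs_lr_nonneg: "obs_lr d \<sigma> \<theta> y \<ge> 0"
  unfolding obs_lr_def by (intro prod_nonneg ballI less_imp_le normal_lr_pos)

lemma obs_law_zero: "\<sigma> > 0 \<Longrightarrow> obs_law d \<sigma> (zero_vec d) = (\<Pi>\<^sub>M j\<in>{1..d}. normal_law 0 \<sigma>)"
  unfolding obs_law_eq_PiM by (rule PiM_cong) (auto simp: zero_vec_def)

text \<open>Compared on boxes: the likelihood ratio and the indicator of a box both factorise over
  the coordinates, so the integral over the box is a product of one-dimensional shifts.\<close>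

lemma obs_law_density:
  assumes "\<sigma> > 0"
  shows "obs_law d \<sigma> \<theta> = density (obs_law d \<sigma> (zero_vec d)) (\<lambda>y. ennreal (obs_lr d \<sigma> \<theta> y))"
proof -
  interpret N: product_prob_space "\<lambda>j::nat. normal_law 0 \<sigma>" "{1..d}"
    using assms by (intro product_prob_spaceI prob_space_normal_density)
  interpret P: product_prob_space "\<lambda>j. normal_law (\<theta> j) \<sigma>" "{1..d}"
    using assms by (intro product_prob_spaceI prob_space_normal_density)
  let ?M = "obs_law d \<sigma> (zero_vec d)"
  have "density ?M (\<lambda>y. ennreal (obs_lr d \<sigma> \<theta> y)) = (\<Pi>\<^sub>M j\<in>{1..d}. normal_law (\<theta> j) \<sigma>)"
  proof (rule P.PiM_eqI)
    show "sets (density ?M (\<lambda>y. ennreal (obs_lr d \<sigma> \<theta> y))) = sets (\<Pi>\<^sub>M j\<in>{1..d}. normal_law (\<theta> j) \<sigma>)"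
      by (simp add: obs_space_def sets_PiM_normal)
    fix A assume "\<And>i. i \<in> {1..d} \<Longrightarrow> A i \<in> sets (normal_law (\<theta> i) \<sigma>)"
    then have A: "\<And>i. i \<in> {1..d} \<Longrightarrow> A i \<in> sets borel" by auto
    then have "Pi\<^sub>E {1..d} A \<in> sets (obs_space d)"
      by (auto simp: obs_space_def intro!: sets_PiM_I_finite)
    then have "emeasure (density ?M (\<lambda>y. ennreal (obs_lr d \<sigma> \<theta> y))) (Pi\<^sub>E {1..d} A)
       = (\<integral>\<^sup>+ y. ennreal (obs_lr d \<sigma> \<theta> y) * indicator (Pi\<^sub>E {1..d} A) y \<partial>?M)"
      by (intro emeasure_density) auto
    also have "\<dots> = (\<integral>\<^sup>+ y. (\<Prod>j\<in>{1..d}. ennreal (normal_lr \<sigma> (\<theta> j) (y j)) * indicator (A j) (y j)) \<partial>?M)"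
    proof (rule nn_integral_cong)
      fix y assume y: "y \<in> space ?M"
      have "indicator (Pi\<^sub>E {1..d} A) y = (\<Prod>j\<in>{1..d}. indicator (A j) (y j) :: ennreal)"
      proof (cases "y \<in> Pi\<^sub>E {1..d} A")
        case True
        then show ?thesis by (simp add: PiE_iff)
      next
        case False
        \<comment> \<open>Points of the space are extensional, so \<open>y\<close> can miss the box
          only at some coordinate.\<close>
        with y obtain j where "j \<in> {1..d}" "y j \<notin> A j"
          by (auto simp: obs_space_def space_PiM PiE_iff)
        then have "(\<Prod>j\<in>{1..d}. indicator (A j) (y j) :: ennreal) = 0"
          by (intro prod_zero) (auto intro!: bexI[of _ j])
        with False show ?thesis by simp
      qed
      then show "ennreal (obs_lr d \<sigma> \<theta> y) * indicator (Pi\<^sub>E {1..d} A) y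
          = (\<Prod>j\<in>{1..d}. ennreal (normal_lr \<sigma> (\<theta> j) (y j)) * indicator (A j) (y j))"
        by (simp add: obs_lr_def prod.distrib prod_ennreal normal_lr_pos less_imp_le)
    qed
    also have "\<dots> = (\<Prod>j\<in>{1..d}. \<integral>\<^sup>+ x. ennreal (normal_lr \<sigma> (\<theta> j) x) * indicator (A j) x \<partial>normal_law 0 \<sigma>)"
      unfolding obs_law_zero[OF assms] using A
      by (intro N.product_nn_integral_prod) auto
    also have "\<dots> = (\<Prod>j\<in>{1..d}. emeasure (normal_law (\<theta> j) \<sigma>) (A j))"
    proof (rule prod.cong)
      fix j assume "j \<in> {1..d}"
      from A[OF this] show "(\<integral>\<^sup>+ x. ennreal (normal_lr \<sigma> (\<theta> j) x) * indicator (A j) x \<partial>normal_law 0 \<sigma>)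
          = emeasure (normal_law (\<theta> j) \<sigma>) (A j)"
        by (simp add: nn_integral_density emeasure_density normal_density_shift[OF assms, of "\<theta> j"]
            ennreal_mult normal_lr_pos less_imp_le mult.assoc)
    qed simp
    finally show "emeasure (density ?M (\<lambda>y. ennreal (obs_lr d \<sigma> \<theta> y))) (Pi\<^sub>E {1..d} A)
        = (\<Prod>j\<in>{1..d}. emeasure (normal_law (\<theta> j) \<sigma>) (A j))" .
  qed simp
  then show ?thesis by (simp add: obs_law_eq_PiM[OF assms, of d \<theta>])
qed

text \<open>By independence the integral is a product; its value is the exponential of the inner
  product of the two mean vectors over the noise variance. These are the entries of the second
  moment of a mixture, and \<open>\<eta> = zero_vec d\<close> gives total mass 1.\<close>

lemma has_bochner_integral_obs_lr_mult:
  assumes "\<sigma> > 0"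
  shows "has_bochner_integral (obs_law d \<sigma> (zero_vec d)) (\<lambda>y. obs_lr d \<sigma> \<theta> y * obs_lr d \<sigma> \<eta> y)
    (\<Prod>j\<in>{1..d}. exp (\<theta> j * \<eta> j / \<sigma>\<^sup>2))"
proof -
  interpret N: product_prob_space "\<lambda>j::nat. normal_law 0 \<sigma>" "{1..d}"
    using assms by (intro product_prob_spaceI prob_space_normal_density)
  have *: "integrable (normal_law 0 \<sigma>) (\<lambda>x. normal_lr \<sigma> (\<theta> j) x * normal_lr \<sigma> (\<eta> j) x)"
    "(\<integral>x. normal_lr \<sigma> (\<theta> j) x * normal_lr \<sigma> (\<eta> j) x \<partial>normal_law 0 \<sigma>) = exp (\<theta> j * \<eta> j / \<sigma>\<^sup>2)" for j
    using has_bochner_integral_normal_lr_mult[OF assms] by (auto simp: has_bochner_integral_iff)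
  show ?thesis
    unfolding has_bochner_integral_iff obs_law_zero[OF assms] obs_lr_def prod.distrib[symmetric]
    using N.product_integrable_prod[of "{1..d}" "\<lambda>j x. normal_lr \<sigma> (\<theta> j) x * normal_lr \<sigma> (\<eta> j) x"]
      N.product_integral_prod[of "{1..d}" "\<lambda>j x. normal_lr \<sigma> (\<theta> j) x * normal_lr \<sigma> (\<eta> j) x"] *
    by simp
qed

section \<open>Mixture lower bounds\<close>

text \<open>Jensen's inequality for the square, read off from the nonnegativity of the variance of
  the absolute value.\<close>

lemma (in prob_space) expectation_abs_le_sqrt:
  fixes X :: "'a \<Rightarrow> real"
  assumes [measurable]: "X \<in> borel_measurable M" and int: "integrable M (\<lambda>x. (X x)\<^sup>2)"
  shows "expectation (\<lambda>x. \<bar>X x\<bar>) \<le> sqrt (expectation (\<lambda>x. (X x)\<^sup>2))"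
proof -
  have "integrable M X"
    using int by (rule square_integrable_imp_integrable[rotated]) auto
  then have "variance (\<lambda>x. \<bar>X x\<bar>) = expectation (\<lambda>x. (X x)\<^sup>2) - (expectation (\<lambda>x. \<bar>X x\<bar>))\<^sup>2"
    using int by (subst variance_eq) auto
  moreover have "variance (\<lambda>x. \<bar>X x\<bar>) \<ge> 0"
    by (rule variance_positive)
  ultimately show ?thesis
    by (intro real_le_rsqrt) simp
qed

text \<open>Le Cam's method with a uniform prior on \<open>F\<close>. The supremum dominates the
  average, so \<open>C\<close> is measured under the mixture density \<open>h\<close>. Replacing
  \<open>h\<close> by 1 costs at most the L1 distance, which is bounded by the root of the
  chi-square divergence, and the double sum of \<open>c\<close> is the unnormalised second moment of
  \<open>h\<close>.\<close>

lemma (in prob_space) mixture_testing_bound: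
  fixes l :: "'b \<Rightarrow> 'a \<Rightarrow> real"
  assumes F: "finite F" "F \<noteq> {}"
    and [measurable]: "\<And>f. f \<in> F \<Longrightarrow> l f \<in> borel_measurable M"
    and nonneg: "\<And>f x. f \<in> F \<Longrightarrow> l f x \<ge> 0"
    and dens: "\<And>f. f \<in> F \<Longrightarrow> expectation (l f) = 1"
    and prod: "\<And>f g. f \<in> F \<Longrightarrow> g \<in> F \<Longrightarrow> has_bochner_integral M (\<lambda>x. l f x * l g x) (c f g)"
    and [measurable]: "E \<in> sets M" "C \<in> sets M" and cover: "E \<union> C = space M"
  shows "ennreal (1 - sqrt ((\<Sum>f\<in>F. \<Sum>g\<in>F. c f g) / (card F)\<^sup>2 - 1))
    \<le> emeasure M E + (SUP f\<in>F. emeasure (density M (\<lambda>x. ennreal (l f x))) C)"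
    (is "_ \<le> _ + ?S")
proof -
  define n where "n = real (card F)"
  have n: "n > 0" unfolding n_def using F card_gt_0_iff[of F] by linarith
  define h where "h x = (\<Sum>f\<in>F. l f x) / n" for x
  have [measurable]: "h \<in> borel_measurable M" unfolding h_def by measurable
  have int_l: "integrable M (l f)" if "f \<in> F" for f
    using prod[OF that that] that
    by - (rule square_integrable_imp_integrable, auto simp: has_bochner_integral_iff power2_eq_square)
  have int_h: "integrable M h" and E_h: "expectation h = 1"
    unfolding h_def using int_l dens n by (auto simp: n_def)
  have h2: "(h x)\<^sup>2 = (\<Sum>f\<in>F. \<Sum>g\<in>F. l f x * l g x) / n\<^sup>2" for x
    by (simp add: h_def power_divide power2_eq_square sum_product)
  have "has_bochner_integral M (\<lambda>x. (h x)\<^sup>2) ((\<Sum>f\<in>F. \<Sum>g\<in>F. c f g) / n\<^sup>2)"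
    unfolding h2 by (intro has_bochner_integral_divide_zero has_bochner_integral_sum prod)
  then have int_h2: "integrable M (\<lambda>x. (h x)\<^sup>2)"
    and E_h2: "expectation (\<lambda>x. (h x)\<^sup>2) = (\<Sum>f\<in>F. \<Sum>g\<in>F. c f g) / n\<^sup>2"
    by (auto simp: has_bochner_integral_iff)
  have sq: "(h x - 1)\<^sup>2 = (h x)\<^sup>2 - 2 * h x + 1" for x
    by (simp add: power2_eq_square algebra_simps)
  have "expectation (\<lambda>x. \<bar>h x - 1\<bar>) \<le> sqrt (expectation (\<lambda>x. (h x - 1)\<^sup>2))"
    unfolding sq using int_h int_h2 by (intro expectation_abs_le_sqrt[of "\<lambda>x. h x - 1", unfolded sq]) auto
  also have "expectation (\<lambda>x. (h x - 1)\<^sup>2) = (\<Sum>f\<in>F. \<Sum>g\<in>F. c f g) / n\<^sup>2 - 1"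
    unfolding sq using int_h int_h2 E_h E_h2 by (simp add: prob_space)
  finally have TV: "expectation (\<lambda>x. \<bar>h x - 1\<bar>) \<le> sqrt ((\<Sum>f\<in>F. \<Sum>g\<in>F. c f g) / n\<^sup>2 - 1)" .
  define p where "p f = expectation (\<lambda>x. l f x * indicator C x)" for f
  have p: "emeasure (density M (\<lambda>x. ennreal (l f x))) C = ennreal (p f)" if "f \<in> F" for f
  proof -
    have "emeasure (density M (\<lambda>x. ennreal (l f x))) C = (\<integral>\<^sup>+ x. ennreal (l f x) * indicator C x \<partial>M)"
      using that by (intro emeasure_density) auto
    also have "\<dots> = (\<integral>\<^sup>+ x. ennreal (l f x * indicator C x) \<partial>M)"
      using that by (intro nn_integral_cong) (auto simp: indicator_def)
    also have "\<dots> = ennreal (p f)"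
      unfolding p_def using that int_l nonneg
      by (intro nn_integral_eq_integral integrable_mult_indicator integrable_real_mult_indicator) auto
    finally show ?thesis .
  qed
  have hC: "expectation (\<lambda>x. h x * indicator C x) = (\<Sum>f\<in>F. p f) / n"
    unfolding h_def p_def using int_l
    by (simp add: sum_distrib_right sum_divide_distrib integrable_real_mult_indicator)
  have "1 \<le> prob E + prob C"
    using measure_Un_le[of E M C] by (simp add: cover prob_space)
  also have "prob C = expectation (indicator C)"
    by simp
  \<comment> \<open>Pointwise: on \<open>C\<close> one has
    \<open>1 \<le> h x + \<bar>h x - 1\<bar>\<close>, and off \<open>C\<close> the right-hand side
    is nonnegative.\<close>
  also have "\<dots> \<le> expectation (\<lambda>x. h x * indicator C x + \<bar>h x - 1\<bar>)"
  proof (rule integral_mono)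
    show "integrable M (indicator C :: _ \<Rightarrow> real)"
      by (rule integrable_real_indicator) (auto simp: emeasure_eq_measure)
    show "integrable M (\<lambda>x. h x * indicator C x + \<bar>h x - 1\<bar>)"
      using int_h by (intro Bochner_Integration.integrable_add integrable_real_mult_indicator) auto
  qed (auto simp: indicator_def)
  also have "\<dots> = expectation (\<lambda>x. h x * indicator C x) + expectation (\<lambda>x. \<bar>h x - 1\<bar>)"
    using int_h by (intro Bochner_Integration.integral_add integrable_real_mult_indicator) auto
  finally have "1 - sqrt ((\<Sum>f\<in>F. \<Sum>g\<in>F. c f g) / n\<^sup>2 - 1) \<le> prob E + (\<Sum>f\<in>F. p f) / n"
    using TV hC by simp
  then have "ennreal (1 - sqrt ((\<Sum>f\<in>F. \<Sum>g\<in>F. c f g) / n\<^sup>2 - 1)) \<le> ennreal (prob E + (\<Sum>f\<in>F. p f) / n)"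
    by (rule ennreal_leI)
  also have "\<dots> \<le> emeasure M E + ennreal ((\<Sum>f\<in>F. p f) / n)"
    by (simp add: emeasure_eq_measure ennreal_plus_if)
  also have "ennreal ((\<Sum>f\<in>F. p f) / n) \<le> ?S"
  proof (cases ?S)
    case (real r)
    have "p f \<le> r" if "f \<in> F" for f
      using SUP_upper[OF that, of "\<lambda>f. emeasure (density M (\<lambda>x. ennreal (l f x))) C"] real p[OF that]
      by (simp add: ennreal_le_iff)
    then have "(\<Sum>f\<in>F. p f) \<le> n * r"
      using sum_bounded_above[of F p r] by (simp add: n_def)
    then have "(\<Sum>f\<in>F. p f) / n \<le> r"
      using n by (simp add: divide_le_eq mult.commute)
    then show ?thesis
      using real by (simp add: ennreal_leI)
  next
    case top
    then show ?thesis by (simp only: top_greatest)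
  qed
  finally show ?thesis
    by (simp add: n_def add_left_mono)
qed

text \<open>The rejection and acceptance regions of any test cover the observation space, so the
  mixture bound applies to each test separately and passes to the infimum.\<close>

lemma testing_risk_ge_mixture:
  fixes \<tau> :: "'i \<Rightarrow> nat \<Rightarrow> real"
  assumes \<sigma>: "\<sigma> > 0" and F: "finite F" "F \<noteq> {}"
    and alt: "\<And>f. f \<in> F \<Longrightarrow> \<tau> f \<in> alternative_set d q u \<delta>"
  shows "ennreal (1 - sqrt ((\<Sum>f\<in>F. \<Sum>g\<in>F. \<Prod>j\<in>{1..d}. exp (\<tau> f j * \<tau> g j / \<sigma>\<^sup>2)) / (card F)\<^sup>2 - 1))
    \<le> testing_risk d \<sigma> q u \<delta>"
  unfolding testing_risk_def
proof (rule INF_greatest)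
  fix \<Delta> assume "\<Delta> \<in> tests d"
  then have \<Delta> [measurable]: "\<Delta> \<in> measurable (obs_space d) (count_space {0, 1})"
    by (simp add: tests_def)
  let ?M = "obs_law d \<sigma> (zero_vec d)"
  let ?E = "{y \<in> space (obs_space d). \<Delta> y = 1}" and ?C = "{y \<in> space (obs_space d). \<Delta> y = 0}"
  interpret prob_space ?M by (rule prob_space_obs_law[OF \<sigma>])
  have EC: "?E = \<Delta> -` {1} \<inter> space (obs_space d)" "?C = \<Delta> -` {0} \<inter> space (obs_space d)" by auto
  have sets: "?E \<in> sets ?M" "?C \<in> sets ?M"
    unfolding EC using measurable_sets[OF \<Delta>, of "{1}"] measurable_sets[OF \<Delta>, of "{0}"] by auto
  have cover: "?E \<union> ?C = space ?M"
    using measurable_space[OF \<Delta>] by (auto simp: insert_iff) (metis One_nat_def not_gr0)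
  have zero: "obs_lr d \<sigma> (zero_vec d) y = 1" for y
    by (simp add: obs_lr_def zero_vec_def normal_lr_def)
  have dens: "expectation (obs_lr d \<sigma> (\<tau> f)) = 1" for f
    using has_bochner_integral_obs_lr_mult[OF \<sigma>, of d "\<tau> f" "zero_vec d"]
    by (simp add: zero has_bochner_integral_iff) (simp add: zero_vec_def)
  have "ennreal (1 - sqrt ((\<Sum>f\<in>F. \<Sum>g\<in>F. \<Prod>j\<in>{1..d}. exp (\<tau> f j * \<tau> g j / \<sigma>\<^sup>2)) / (card F)\<^sup>2 - 1))
      \<le> emeasure ?M ?E + (SUP f\<in>F. emeasure (density ?M (\<lambda>y. ennreal (obs_lr d \<sigma> (\<tau> f) y))) ?C)"
    by (rule mixture_testing_bound)
       (use F sets cover dens in \<open>auto intro!: has_bochner_integral_obs_lr_mult \<sigma> simp: obs_lr_nonneg simp del: One_nat_def\<close>)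
  also have "(SUP f\<in>F. emeasure (density ?M (\<lambda>y. ennreal (obs_lr d \<sigma> (\<tau> f) y))) ?C)
      \<le> (SUP \<theta>\<in>alternative_set d q u \<delta>. emeasure (obs_law d \<sigma> \<theta>) ?C)"
    by (rule SUP_mono) (use alt in \<open>auto simp flip: obs_law_density[OF \<sigma>] intro!: bexI\<close>)
  finally show "ennreal (1 - sqrt ((\<Sum>f\<in>F. \<Sum>g\<in>F. \<Prod>j\<in>{1..d}. exp (\<tau> f j * \<tau> g j / \<sigma>\<^sup>2)) / (card F)\<^sup>2 - 1))
      \<le> emeasure ?M ?E + (SUP \<theta>\<in>alternative_set d q u \<delta>. emeasure (obs_law d \<sigma> \<theta>) ?C)"
    by (simp add: add_left_mono)
qed

text \<open>
  Block \<open>i\<close> consists of the coordinates \<open>i * k + 1, \<dots>, i * k + k\<close>. With independent positions in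
  the blocks the overlap of two such vectors is binomial, whereas that of two uniformly chosen
  \<open>s\<close>-subsets would be hypergeometric.
\<close>

definition block_vec :: "nat \<Rightarrow> nat \<Rightarrow> nat \<Rightarrow> real \<Rightarrow> (nat \<Rightarrow> nat) \<Rightarrow> nat \<Rightarrow> real" where
  "block_vec d s k a f =
     (\<lambda>j\<in>{1..d}. if (j - 1) div k < s \<and> (j - 1) mod k = f ((j - 1) div k) then a else 0)"

section \<open>Second moment of the block mixture\<close>

context
  fixes d s k :: nat and F
  assumes k: "k > 0" and d: "s * k \<le> d"
  defines "F \<equiv> {..<s} \<rightarrow>\<^sub>E {..<k}"
begin

lemma block_index:
  assumes "f \<in> F" "i < s"
  shows "i * k + f i + 1 \<in> {1..d}" "(i * k + f i) div k = i" "(i * k + f i) mod k = f i"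
proof -
  have fi: "f i < k" using assms by (auto simp: F_def)
  have "i * k + f i < (i + 1) * k" using fi by simp
  also have "\<dots> \<le> s * k" using assms by (intro mult_right_mono) auto
  finally show "i * k + f i + 1 \<in> {1..d}" using d by auto
  show "(i * k + f i) div k = i" "(i * k + f i) mod k = f i"
    using fi k by simp_all
qed

lemma block_vec_index:
  assumes "f \<in> F" "i < s"
  shows "block_vec d s k a g (i * k + f i + 1) = (if f i = g i then a else 0)"
  using block_index[OF assms] assms(2) by (simp add: block_vec_def)

lemma block_vec_support:
  assumes "f \<in> F" "j \<in> {1..d}" "j \<notin> (\<lambda>i. i * k + f i + 1) ` {..<s}"
  shows "block_vec d s k a f j = 0"
proof (rule ccontr)
  assume "block_vec d s k a f j \<noteq> 0"
  then have *: "(j - 1) div k < s" "(j - 1) mod k = f ((j - 1) div k)"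
    using assms by (auto simp: block_vec_def split: if_splits)
  have "j = (j - 1) div k * k + f ((j - 1) div k) + 1"
    using assms(2) *(2) div_mult_mod_eq[of "j - 1" k] by simp
  with * assms(3) show False by blast
qed

lemma block_index_inj: "f \<in> F \<Longrightarrow> inj_on (\<lambda>i. i * k + f i + 1) {..<s}"
  by (rule inj_onI) (metis add_right_cancel block_index(2) lessThan_iff)

text \<open>Only the \<open>s\<close> spikes contribute because \<open>\<phi>\<close> vanishes at 0.
  Taking for \<open>\<phi>\<close> a power of the absolute value or the indicator of nonzero values
  gives all the norms needed of these vectors.\<close>

lemma sum_block_vec:
  assumes "f \<in> F" "\<phi> 0 = (0::real)"
  shows "(\<Sum>j\<in>{1..d}. \<phi> (block_vec d s k a f j)) = real s * \<phi> a"
proof -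
  have "(\<Sum>j\<in>{1..d}. \<phi> (block_vec d s k a f j))
      = (\<Sum>j\<in>(\<lambda>i. i * k + f i + 1) ` {..<s}. \<phi> (block_vec d s k a f j))"
    using block_vec_support[OF assms(1)] block_index(1)[OF assms(1)] assms(2)
    by (intro sum.mono_neutral_right) auto
  also have "\<dots> = (\<Sum>i<s. \<phi> a)"
    by (subst sum.reindex) (use assms block_vec_index[OF assms(1)] block_index_inj[OF assms(1)] in \<open>auto\<close>)
  finally show ?thesis by simp
qed

text \<open>At the spikes of \<open>f\<close> the other vector equals \<open>a\<close> where both
  choose the same position and 0 elsewhere, so only the blocks in which \<open>f\<close> and
  \<open>g\<close> agree contribute a factor.\<close>

lemma prod_block_vec:
  assumes "f \<in> F"
  shows "(\<Prod>j\<in>{1..d}. exp (block_vec d s k a f j * block_vec d s k a g j / v))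
    = (\<Prod>i<s. if f i = g i then exp (a\<^sup>2 / v) else 1)"
proof -
  have "(\<Prod>j\<in>{1..d}. exp (block_vec d s k a f j * block_vec d s k a g j / v))
      = (\<Prod>j\<in>(\<lambda>i. i * k + f i + 1) ` {..<s}. exp (block_vec d s k a f j * block_vec d s k a g j / v))"
    using block_vec_support[OF assms(1)] block_index(1)[OF assms(1)]
    by (intro prod.mono_neutral_right) auto
  also have "\<dots> = (\<Prod>i<s. if f i = g i then exp (a\<^sup>2 / v) else 1)"
    by (subst prod.reindex)
       (use assms block_vec_index[OF assms(1)] block_index_inj[OF assms(1)] in \<open>auto simp: power2_eq_square intro!: prod.cong\<close>)
  finally show ?thesis .
qed

text \<open>Summing a product over all choice functions exchanges sum and product. For fixed
  \<open>f\<close> every block has exactly one agreeing position among \<open>k\<close>, so the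
  inner sum is the same for all \<open>f\<close>.\<close>

lemma second_moment_block_vec:
  "(\<Sum>f\<in>F. \<Sum>g\<in>F. \<Prod>j\<in>{1..d}. exp (block_vec d s k a f j * block_vec d s k a g j / v)) / (card F)\<^sup>2
    = (1 + (exp (a\<^sup>2 / v) - 1) / k) ^ s"
proof -
  have card: "real (card F) = real k ^ s" by (simp add: F_def card_PiE)
  have row: "(\<Sum>b<k. if c = b then exp (a\<^sup>2 / v) else 1) = exp (a\<^sup>2 / v) - 1 + real k" if "c < k" for c
  proof -
    have "(\<Sum>b<k. if c = b then exp (a\<^sup>2 / v) else 1) = (\<Sum>b<k. (if c = b then exp (a\<^sup>2 / v) - 1 else 0) + 1)"
      by (intro sum.cong) auto
    also have "\<dots> = exp (a\<^sup>2 / v) - 1 + real k"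
      using that by (subst sum.distrib) (simp add: sum.delta)
    finally show ?thesis .
  qed
  have "(\<Sum>g\<in>F. \<Prod>i<s. if f i = g i then exp (a\<^sup>2 / v) else 1) = (exp (a\<^sup>2 / v) - 1 + real k) ^ s"
    if f: "f \<in> F" for f
  proof -
    have "(\<Sum>g\<in>F. \<Prod>i<s. if f i = g i then exp (a\<^sup>2 / v) else 1)
        = (\<Prod>i<s. \<Sum>b<k. if f i = b then exp (a\<^sup>2 / v) else 1)"
      unfolding F_def by (subst prod_sum_PiE) auto
    also have "\<dots> = (\<Prod>i<s. exp (a\<^sup>2 / v) - 1 + real k)"
      using f by (intro prod.cong refl row) (auto simp: F_def)
    finally show ?thesis by simp
  qed
  then have "(\<Sum>f\<in>F. \<Sum>g\<in>F. \<Prod>j\<in>{1..d}. exp (block_vec d s k a f j * block_vec d s k a g j / v))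
      = real k ^ s * (exp (a\<^sup>2 / v) - 1 + real k) ^ s"
    by (simp add: prod_block_vec card cong: sum.cong del: One_nat_def)
  then show ?thesis
    using k by (simp add: card power2_eq_square flip: power_mult_distrib power_divide)
      (simp add: field_simps)
qed

end

text \<open>Convexity of the exponential between 0 and \<open>ln (1 + x)\<close>, a form of
  Bernoulli's inequality. With \<open>p = A\<^sup>2\<close> it makes the excess of the second moment
  linear in \<open>A\<^sup>2\<close>.\<close>

lemma exp_mult_ln_le:
  fixes p x :: real
  assumes "0 \<le> p" "p \<le> 1" "x \<ge> 0"
  shows "exp (p * ln (1 + x)) \<le> 1 + p * x"
proof -
  have "exp ((1 - p) *\<^sub>R 0 + p *\<^sub>R ln (1 + x)) \<le> (1 - p) * exp 0 + p * exp (ln (1 + x))"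
    using assms by (intro convex_onD[OF exp_convex]) auto
  then show ?thesis using assms by (simp add: algebra_simps)
qed

definition sparsity_log :: "nat \<Rightarrow> nat \<Rightarrow> real" where
  "sparsity_log d s = ln (1 + real d / (real s)\<^sup>2)"

text \<open>The height \<open>a\<close> is kept free below its cap because on an lq-ball with
  effective sparsity 0 it is dictated by the radius, not by the logarithm. The hypotheses on
  \<open>q\<close> and \<open>u\<close> say that a vector with \<open>s\<close> entries equal to
  \<open>a\<close> lies in the ball.\<close>

lemma testing_risk_lower:
  assumes \<sigma>: "\<sigma> > 0" and s: "1 \<le> s" "s \<le> d" and A: "0 \<le> A" "A \<le> 1"
    and a: "0 \<le> a" "a\<^sup>2 \<le> A\<^sup>2 * \<sigma>\<^sup>2 * sparsity_log d s"
    and q: "q \<ge> 0" "if q = 0 then real s \<le> u else (real s * a powr q) powr (1 / q) \<le> u"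
    and \<delta>: "\<delta> \<le> sqrt (real s) * a"
  shows "ennreal (1 - sqrt (exp (2 * A\<^sup>2) - 1)) \<le> testing_risk d \<sigma> q u \<delta>"
proof -
  define k where "k = d div s"
  have k: "k > 0" using s by (simp add: k_def div_greater_zero_iff)
  have sk: "s * k \<le> d" by (simp add: k_def)
  define F where "F = {..<s} \<rightarrow>\<^sub>E {..<k}"
  have F: "finite F" "F \<noteq> {}"
    using k by (auto simp: F_def PiE_eq_empty_iff intro!: finite_PiE)
  let ?\<tau> = "block_vec d s k a"
  have alt: "?\<tau> f \<in> alternative_set d q u \<delta>" if f: "f \<in> F" for f
  proof -
    note S = sum_block_vec[OF k sk f[unfolded F_def], where a=a]
    have vec: "?\<tau> f \<in> vec_space d"
      by (simp add: vec_space_def block_vec_def)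
    have "lq_norm d 2 (?\<tau> f) = (real s * \<bar>a\<bar> powr 2) powr (1 / 2)"
      using S[of "\<lambda>x. \<bar>x\<bar> powr 2"] by (simp add: lq_norm_def)
    also have "\<dots> = sqrt (real s) * a"
      using a by (simp add: powr_half_sqrt real_sqrt_mult)
    finally have n2: "\<delta> \<le> lq_norm d 2 (?\<tau> f)" using \<delta> by simp
    have "lq_norm d q (?\<tau> f) \<le> u"
    proof (cases "q = 0")
      case True
      have "real (card {j\<in>{1..d}. ?\<tau> f j \<noteq> 0}) = (\<Sum>j\<in>{1..d}. if ?\<tau> f j \<noteq> 0 then 1 else 0)"
        by (subst sum.If_cases) (auto simp: Int_def)
      also have "\<dots> \<le> real s"
        using S[of "\<lambda>x. if x \<noteq> 0 then 1 else 0"] by (simp split: if_splits)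
      finally show ?thesis using True q by (simp add: lq_norm_def)
    next
      case False
      then show ?thesis
        using S[of "\<lambda>x. \<bar>x\<bar> powr q"] q a by (simp add: lq_norm_def)
    qed
    with vec n2 show ?thesis by (simp add: alternative_set_def lq_ball_def)
  qed
  have A2: "A\<^sup>2 \<le> 1" using A by (simp add: power_le_one)
  have "exp (a\<^sup>2 / \<sigma>\<^sup>2) \<le> exp (A\<^sup>2 * sparsity_log d s)"
    using a \<sigma> by (simp add: divide_le_eq mult_ac)
  also have "\<dots> \<le> 1 + A\<^sup>2 * (real d / (real s)\<^sup>2)"
    unfolding sparsity_log_def using A2 by (intro exp_mult_ln_le) auto
  finally have E: "exp (a\<^sup>2 / \<sigma>\<^sup>2) - 1 \<le> A\<^sup>2 * (real d / (real s)\<^sup>2)" by simp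
  \<comment> \<open>Rounding \<open>d / s\<close> down to \<open>k\<close> loses at most a factor 2,
    since \<open>k\<close> is at least 1; this is the 2 in
    \<open>exp (2 * A\<^sup>2)\<close>.\<close>
  have "d < (k + 1) * s"
    using s dividend_less_times_div[of s d] by (simp add: k_def algebra_simps)
  also have "\<dots> \<le> 2 * k * s" using k by (intro mult_right_mono) auto
  finally have dk: "real d \<le> 2 * real k * real s"
    by (metis less_imp_le of_nat_le_iff of_nat_mult of_nat_numeral)
  have "(exp (a\<^sup>2 / \<sigma>\<^sup>2) - 1) / k \<le> A\<^sup>2 * (real d / (real s)\<^sup>2) / k"
    using E k by (intro divide_right_mono) auto
  also have "\<dots> \<le> A\<^sup>2 * (2 * real k * real s / (real s)\<^sup>2) / k"
    using dk by (intro divide_right_mono mult_left_mono) auto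
  also have "\<dots> = 2 * A\<^sup>2 / s"
    using k s by (simp add: field_simps power2_eq_square)
  finally have "(exp (a\<^sup>2 / \<sigma>\<^sup>2) - 1) / k \<le> 2 * A\<^sup>2 / s" .
  then have "1 + (exp (a\<^sup>2 / \<sigma>\<^sup>2) - 1) / k \<le> exp (2 * A\<^sup>2 / s)"
    using exp_ge_add_one_self[of "2 * A\<^sup>2 / s"] by linarith
  then have "(1 + (exp (a\<^sup>2 / \<sigma>\<^sup>2) - 1) / k) ^ s \<le> exp (2 * A\<^sup>2 / s) ^ s"
    by (intro power_mono) (auto intro: add_nonneg_nonneg)
  also have "\<dots> = exp (2 * A\<^sup>2)"
    using s by (simp flip: exp_of_nat_mult)
  finally have "sqrt ((1 + (exp (a\<^sup>2 / \<sigma>\<^sup>2) - 1) / k) ^ s - 1) \<le> sqrt (exp (2 * A\<^sup>2) - 1)"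
    by simp
  then have "ennreal (1 - sqrt (exp (2 * A\<^sup>2) - 1)) \<le> ennreal (1 - sqrt ((1 + (exp (a\<^sup>2 / \<sigma>\<^sup>2) - 1) / k) ^ s - 1))"
    by (intro ennreal_leI) simp
  also have "\<dots> \<le> testing_risk d \<sigma> q u \<delta>"
    using testing_risk_ge_mixture[of \<sigma> F ?\<tau>, OF \<sigma> F alt]
    unfolding second_moment_block_vec[OF k sk, folded F_def] .
  finally show ?thesis .
qed

section \<open>Thresholded quadratic tests\<close>

text \<open>Expand the square: off the diagonal, independence splits the integral into factors that
  vanish by centring.\<close>

lemma (in product_prob_space) expectation_square_sum_PiM:
  fixes f :: "'i \<Rightarrow> 'a \<Rightarrow> real"
  assumes I: "finite I"
    and meas: "\<And>i. i \<in> I \<Longrightarrow> f i \<in> borel_measurable (M i)"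
    and sq: "\<And>i. i \<in> I \<Longrightarrow> integrable (M i) (\<lambda>x. (f i x)\<^sup>2)"
    and zero: "\<And>i. i \<in> I \<Longrightarrow> (\<integral>x. f i x \<partial>M i) = 0"
  shows "has_bochner_integral (Pi\<^sub>M I M) (\<lambda>x. (\<Sum>i\<in>I. f i (x i))\<^sup>2) (\<Sum>i\<in>I. \<integral>x. (f i x)\<^sup>2 \<partial>M i)"
proof -
  have int: "integrable (M i) (f i)" if "i \<in> I" for i
    using that by (intro M.square_integrable_imp_integrable[OF meas sq])
  have pair: "has_bochner_integral (Pi\<^sub>M I M) (\<lambda>x. f i (x i) * f j (x j))
      (if i = j then \<integral>x. (f i x)\<^sup>2 \<partial>M i else 0)" if ij: "i \<in> I" "j \<in> I" for i j
  proof -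
    \<comment> \<open>The two factors sit at coordinates \<open>i\<close> and \<open>j\<close>, and
      the others are 1. For \<open>i = j\<close> they meet in one coordinate and form the square, so
      a single product formula serves both cases.\<close>
    define g where "g k x = (if k = i then f i x else 1) * (if k = j then f j x else 1)" for k x
    have g_int: "integrable (M k) (g k)" if k: "k \<in> I" for k
      using int[OF k] sq[OF k] unfolding g_def
      by (cases "k = i"; cases "k = j") (auto simp: power2_eq_square)
    have g_prod: "(\<Prod>k\<in>I. g k (x k)) = f i (x i) * f j (x j)" for x
    proof -
      have "(\<Prod>k\<in>I. g k (x k))
          = (\<Prod>k\<in>I. if k = i then f i (x i) else 1) * (\<Prod>k\<in>I. if k = j then f j (x j) else 1)"
        unfolding prod.distrib[symmetric] by (intro prod.cong) (auto simp: g_def)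
      then show ?thesis using I ij by (simp add: prod.delta)
    qed
    have "(\<Prod>k\<in>I. \<integral>x. g k x \<partial>M k) = (if i = j then \<integral>x. (f i x)\<^sup>2 \<partial>M i else 0)"
    proof (cases "i = j")
      case True
      have "(\<Prod>k\<in>I. \<integral>x. g k x \<partial>M k) = (\<Prod>k\<in>I. if k = i then \<integral>x. (f i x)\<^sup>2 \<partial>M i else 1)"
        using True by (intro prod.cong) (auto simp: g_def power2_eq_square M.prob_space)
      then show ?thesis using True I ij by (simp add: prod.delta)
    next
      case False
      then have "(\<integral>x. g i x \<partial>M i) = 0" using zero[OF ij(1)] by (simp add: g_def)
      then have "(\<Prod>k\<in>I. \<integral>x. g k x \<partial>M k) = 0" using I ij by (intro prod_zero) auto
      then show ?thesis using False by simp
    qed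
    then show ?thesis
      using product_integrable_prod[OF I, of g] product_integral_prod[OF I, of g] g_int g_prod
      by (simp add: has_bochner_integral_iff)
  qed
  have "has_bochner_integral (Pi\<^sub>M I M) (\<lambda>x. \<Sum>i\<in>I. \<Sum>j\<in>I. f i (x i) * f j (x j))
      (\<Sum>i\<in>I. \<Sum>j\<in>I. if i = j then \<integral>x. (f i x)\<^sup>2 \<partial>M i else 0)"
    by (intro has_bochner_integral_sum pair)
  also have "(\<Sum>i\<in>I. \<Sum>j\<in>I. if i = j then \<integral>x. (f i x)\<^sup>2 \<partial>M i else 0) = (\<Sum>i\<in>I. \<integral>x. (f i x)\<^sup>2 \<partial>M i)"
    using I by simp
  finally show ?thesis by (simp add: power2_eq_square sum_product)
qed

definition shift_mean :: "(real \<Rightarrow> real) \<Rightarrow> real \<Rightarrow> real" where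
  "shift_mean \<phi> t = (\<integral>x. \<phi> (t + x) \<partial>std_normal_distribution)"

definition shift_var :: "(real \<Rightarrow> real) \<Rightarrow> real \<Rightarrow> real" where
  "shift_var \<phi> t = (\<integral>x. (\<phi> (t + x) - shift_mean \<phi> t)\<^sup>2 \<partial>std_normal_distribution)"

interpretation std_normal: prob_space std_normal_distribution
  by (rule prob_space_normal_density) simp

text \<open>Chebyshev's inequality, with the variance of the sum computed from independence.\<close>

lemma shift_deviation:
  fixes t :: "nat \<Rightarrow> real" and d :: nat
  assumes [measurable]: "\<phi> \<in> borel_measurable borel"
    and sq: "\<And>t. integrable std_normal_distribution (\<lambda>x. (\<phi> (t + x))\<^sup>2)"
    and a: "a > 0"
  defines "N \<equiv> \<Pi>\<^sub>M j\<in>{1..d}. std_normal_distribution"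
  shows "measure N {\<xi>\<in>space N. a \<le> \<bar>\<Sum>j\<in>{1..d}. \<phi> (t j + \<xi> j) - shift_mean \<phi> (t j)\<bar>}
    \<le> (\<Sum>j\<in>{1..d}. shift_var \<phi> (t j)) / a\<^sup>2"
proof -
  interpret N: product_prob_space "\<lambda>j::nat. std_normal_distribution" "{1..d}"
    by (intro product_prob_spaceI prob_space_normal_density) simp
  interpret P: prob_space N unfolding N_def by (rule N.P.prob_space_axioms)
  define f where "f j x = \<phi> (t j + x) - shift_mean \<phi> (t j)" for j x
  have [measurable]: "f j \<in> borel_measurable borel" for j unfolding f_def by measurable
  have int: "integrable std_normal_distribution (\<lambda>x. \<phi> (t + x))" for t
    using sq[of t] by - (rule std_normal.square_integrable_imp_integrable, auto)
  have f_sq: "(f j x)\<^sup>2 = (\<phi> (t j + x))\<^sup>2 - 2 * shift_mean \<phi> (t j) * \<phi> (t j + x) + (shift_mean \<phi> (t j))\<^sup>2" for j x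
    by (simp add: f_def power2_eq_square algebra_simps)
  have int_f2: "integrable std_normal_distribution (\<lambda>x. (f j x)\<^sup>2)" for j
    unfolding f_sq using sq[of "t j"] int[of "t j"] by auto
  have mean_f: "(\<integral>x. f j x \<partial>std_normal_distribution) = 0" for j
    unfolding f_def using int[of "t j"] std_normal.prob_space by (simp add: shift_mean_def)
  have S: "has_bochner_integral N (\<lambda>\<xi>. (\<Sum>j\<in>{1..d}. f j (\<xi> j))\<^sup>2) (\<Sum>j\<in>{1..d}. shift_var \<phi> (t j))"
    using N.expectation_square_sum_PiM[of f, OF _ _ int_f2 mean_f]
    by (simp add: N_def shift_var_def f_def[symmetric])
  have [measurable]: "(\<lambda>\<xi>. \<Sum>j\<in>{1..d}. f j (\<xi> j)) \<in> borel_measurable N" unfolding N_def by measurable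
  have "P.prob {\<xi>\<in>space N. a\<^sup>2 \<le> (\<Sum>j\<in>{1..d}. f j (\<xi> j))\<^sup>2} \<le> (\<Sum>j\<in>{1..d}. shift_var \<phi> (t j)) / a\<^sup>2"
    using integral_Markov_inequality_measure[of N "\<lambda>\<xi>. (\<Sum>j\<in>{1..d}. f j (\<xi> j))\<^sup>2" "{}" "a\<^sup>2"] S a
    by (simp add: has_bochner_integral_iff)
  moreover have "a\<^sup>2 \<le> x\<^sup>2 \<longleftrightarrow> a \<le> \<bar>x\<bar>" for x :: real
    using a by (metis abs_le_square_iff abs_of_pos)
  ultimately show ?thesis by (simp add: f_def)
qed

lemma emeasure_obs_law:
  fixes d :: nat
  assumes "B \<in> sets (obs_space d)"
  defines "N \<equiv> \<Pi>\<^sub>M j\<in>{1..d}. std_normal_distribution"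
  shows "emeasure (obs_law d \<sigma> \<theta>) B = emeasure N {\<xi>\<in>space N. (\<lambda>j\<in>{1..d}. \<theta> j + \<sigma> * \<xi> j) \<in> B}"
proof -
  have "(\<lambda>\<xi>. \<lambda>j\<in>{1..d}. \<theta> j + \<sigma> * \<xi> j) \<in> measurable N (obs_space d)"
    unfolding obs_space_def N_def by measurable
  then show ?thesis
    unfolding obs_law_def N_def[symmetric] using assms(1)
    by (subst emeasure_distr) (auto intro!: arg_cong[where f="emeasure _"])
qed

text \<open>The test rejects when the sum of \<open>\<phi> (y j / \<sigma>)\<close>, centred under
  the null hypothesis, reaches \<open>K\<close>. Chebyshev's inequality bounds each error by
  \<open>\<epsilon> / 2\<close>. The margin \<open>D\<close> may depend on \<open>\<theta>\<close>,
  because a stronger signal can have a larger variance along with its larger mean.\<close>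

lemma testing_risk_le:
  fixes \<phi> :: "real \<Rightarrow> real"
  assumes \<sigma>: "\<sigma> > 0" and \<epsilon>: "\<epsilon> > 0" and K: "K > 0"
    and [measurable]: "\<phi> \<in> borel_measurable borel"
    and sq: "\<And>t. integrable std_normal_distribution (\<lambda>x. (\<phi> (t + x))\<^sup>2)"
    and null: "real d * shift_var \<phi> 0 \<le> \<epsilon> / 2 * K\<^sup>2"
    and alt: "\<And>\<theta>. \<theta> \<in> alternative_set d q u \<delta> \<Longrightarrow>
      \<exists>D>0. K + D \<le> (\<Sum>j\<in>{1..d}. shift_mean \<phi> (\<theta> j / \<sigma>) - shift_mean \<phi> 0)
        \<and> (\<Sum>j\<in>{1..d}. shift_var \<phi> (\<theta> j / \<sigma>)) \<le> \<epsilon> / 2 * D\<^sup>2"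
  shows "testing_risk d \<sigma> q u \<delta> \<le> ennreal \<epsilon>"
proof -
  let ?N = "\<Pi>\<^sub>M j\<in>{1..d}. std_normal_distribution"
  interpret N: product_prob_space "\<lambda>j::nat. std_normal_distribution" "{1..d}"
    by (intro product_prob_spaceI prob_space_normal_density) simp
  let ?T = "\<lambda>y. \<Sum>j\<in>{1..d}. \<phi> (y j / \<sigma>) - shift_mean \<phi> 0"
  have T [measurable]: "?T \<in> borel_measurable (obs_space d)" unfolding obs_space_def by measurable
  have space_shift: "(\<lambda>j\<in>{1..d}. \<theta> j + \<sigma> * \<xi> j) \<in> space (obs_space d)" for \<theta> \<xi>
    by (auto simp: obs_space_def space_PiM)
  have dev_sets: "{\<xi>\<in>space ?N. a \<le> \<bar>\<Sum>j\<in>{1..d}. \<phi> (t j + \<xi> j) - shift_mean \<phi> (t j)\<bar>} \<in> sets ?N" for a t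
    by measurable
  define \<Delta> :: "(nat \<Rightarrow> real) \<Rightarrow> nat" where "\<Delta> y = (if K \<le> ?T y then 1 else 0)" for y
  have \<Delta>: "\<Delta> \<in> tests d"
    unfolding tests_def \<Delta>_def by measurable
  have \<Delta>1: "{y\<in>space (obs_space d). \<Delta> y = 1} = {y\<in>space (obs_space d). K \<le> ?T y}"
    and \<Delta>0: "{y\<in>space (obs_space d). \<Delta> y = 0} = {y\<in>space (obs_space d). \<not> K \<le> ?T y}"
    by (auto simp: \<Delta>_def)
  have err1: "emeasure (obs_law d \<sigma> (zero_vec d)) {y\<in>space (obs_space d). \<Delta> y = 1} \<le> ennreal (\<epsilon> / 2)"
  proof -
    have "emeasure (obs_law d \<sigma> (zero_vec d)) {y\<in>space (obs_space d). \<Delta> y = 1}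
        = emeasure ?N {\<xi>\<in>space ?N. K \<le> (\<Sum>j\<in>{1..d}. \<phi> (zero_vec d j / \<sigma> + \<xi> j) - shift_mean \<phi> 0)}"
      unfolding \<Delta>1 using \<sigma>
      by (subst emeasure_obs_law) (measurable, simp add: space_shift add_divide_distrib del: sum_subtractf One_nat_def)
    also have "\<dots> \<le> emeasure ?N {\<xi>\<in>space ?N. K \<le> \<bar>\<Sum>j\<in>{1..d}. \<phi> (0 + \<xi> j) - shift_mean \<phi> 0\<bar>}"
    proof (rule emeasure_mono)
      have "(\<Sum>j\<in>{1..d}. \<phi> (zero_vec d j / \<sigma> + \<xi> j) - shift_mean \<phi> 0) = (\<Sum>j\<in>{1..d}. \<phi> (0 + \<xi> j) - shift_mean \<phi> 0)" for \<xi>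
        by (intro sum.cong) (auto simp: zero_vec_def)
      then show "{\<xi>\<in>space ?N. K \<le> (\<Sum>j\<in>{1..d}. \<phi> (zero_vec d j / \<sigma> + \<xi> j) - shift_mean \<phi> 0)}
          \<subseteq> {\<xi>\<in>space ?N. K \<le> \<bar>\<Sum>j\<in>{1..d}. \<phi> (0 + \<xi> j) - shift_mean \<phi> 0\<bar>}"
        by (auto simp del: sum_subtractf)
    qed (use dev_sets[of K "\<lambda>_. 0"] in simp)
    also have "\<dots> \<le> ennreal ((\<Sum>j\<in>{1..d}. shift_var \<phi> 0) / K\<^sup>2)"
      unfolding N.P.emeasure_eq_measure using shift_deviation[OF _ sq K, of d "\<lambda>_. 0"]
      by (intro ennreal_leI) simp
    also have "\<dots> \<le> ennreal (\<epsilon> / 2)"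
      using null K by (intro ennreal_leI) (simp add: divide_le_eq)
    finally show ?thesis .
  qed
  have err2: "emeasure (obs_law d \<sigma> \<theta>) {y\<in>space (obs_space d). \<Delta> y = 0} \<le> ennreal (\<epsilon> / 2)"
    if \<theta>: "\<theta> \<in> alternative_set d q u \<delta>" for \<theta>
  proof -
    obtain D where D: "D > 0" "K + D \<le> (\<Sum>j\<in>{1..d}. shift_mean \<phi> (\<theta> j / \<sigma>) - shift_mean \<phi> 0)"
      "(\<Sum>j\<in>{1..d}. shift_var \<phi> (\<theta> j / \<sigma>)) \<le> \<epsilon> / 2 * D\<^sup>2"
      using alt[OF \<theta>] by blast
    have "emeasure (obs_law d \<sigma> \<theta>) {y\<in>space (obs_space d). \<Delta> y = 0}
        = emeasure ?N {\<xi>\<in>space ?N. \<not> K \<le> (\<Sum>j\<in>{1..d}. \<phi> (\<theta> j / \<sigma> + \<xi> j) - shift_mean \<phi> 0)}"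
      unfolding \<Delta>0 using \<sigma>
      by (subst emeasure_obs_law) (measurable, simp add: space_shift add_divide_distrib del: sum_subtractf One_nat_def not_le)
    also have "\<dots> \<le> emeasure ?N {\<xi>\<in>space ?N. D \<le> \<bar>\<Sum>j\<in>{1..d}. \<phi> (\<theta> j / \<sigma> + \<xi> j) - shift_mean \<phi> (\<theta> j / \<sigma>)\<bar>}"
    proof (rule emeasure_mono)
      \<comment> \<open>Centring at the mean under \<open>\<theta>\<close> instead of the null mean
        lowers the statistic by at least \<open>K + D\<close>, so staying below \<open>K\<close>
        forces a deviation of at least \<open>D\<close>.\<close>
      have "(\<Sum>j\<in>{1..d}. \<phi> (\<theta> j / \<sigma> + \<xi> j) - shift_mean \<phi> (\<theta> j / \<sigma>))
          = (\<Sum>j\<in>{1..d}. \<phi> (\<theta> j / \<sigma> + \<xi> j) - shift_mean \<phi> 0)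
            - (\<Sum>j\<in>{1..d}. shift_mean \<phi> (\<theta> j / \<sigma>) - shift_mean \<phi> 0)" for \<xi>
        by (simp add: sum_subtractf)
      then show "{\<xi>\<in>space ?N. \<not> K \<le> (\<Sum>j\<in>{1..d}. \<phi> (\<theta> j / \<sigma> + \<xi> j) - shift_mean \<phi> 0)}
          \<subseteq> {\<xi>\<in>space ?N. D \<le> \<bar>\<Sum>j\<in>{1..d}. \<phi> (\<theta> j / \<sigma> + \<xi> j) - shift_mean \<phi> (\<theta> j / \<sigma>)\<bar>}"
        using D(2) by (auto simp del: sum_subtractf)
    qed (rule dev_sets)
    also have "\<dots> \<le> ennreal ((\<Sum>j\<in>{1..d}. shift_var \<phi> (\<theta> j / \<sigma>)) / D\<^sup>2)"
      unfolding N.P.emeasure_eq_measure using shift_deviation[OF _ sq D(1), of d "\<lambda>j. \<theta> j / \<sigma>"]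
      by (intro ennreal_leI) simp
    also have "\<dots> \<le> ennreal (\<epsilon> / 2)"
      using D by (intro ennreal_leI) (simp add: divide_le_eq)
    finally show ?thesis .
  qed
  have "testing_risk d \<sigma> q u \<delta>
      \<le> emeasure (obs_law d \<sigma> (zero_vec d)) {y\<in>space (obs_space d). \<Delta> y = 1}
        + (SUP \<theta>\<in>alternative_set d q u \<delta>. emeasure (obs_law d \<sigma> \<theta>) {y\<in>space (obs_space d). \<Delta> y = 0})"
    unfolding testing_risk_def by (rule INF_lower[OF \<Delta>])
  also have "\<dots> \<le> ennreal (\<epsilon> / 2) + ennreal (\<epsilon> / 2)"
    by (intro add_mono SUP_least err1 err2)
  also have "\<dots> = ennreal \<epsilon>"
    using \<epsilon> by (simp flip: ennreal_plus)
  finally show ?thesis .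
qed

section \<open>Gaussian moments\<close>

lemma has_bochner_integral_std_normal_even_moment:
  "has_bochner_integral std_normal_distribution (\<lambda>x. x ^ (2 * k)) (fact (2 * k) / (2 ^ k * fact k))"
  using std_normal_moment_even[of k]
  by (simp add: has_bochner_integral_iff integrable_normal_law_iff integral_normal_law)

lemma has_bochner_integral_std_normal_power2:
  "has_bochner_integral std_normal_distribution (\<lambda>x. x\<^sup>2) 1"
  using has_bochner_integral_std_normal_even_moment[of 1] by (simp add: fact_numeral)

lemma has_bochner_integral_std_normal_power4:
  "has_bochner_integral std_normal_distribution (\<lambda>x. x ^ 4) 3"
  using has_bochner_integral_std_normal_even_moment[of 2] by (simp add: fact_numeral)

lemma has_bochner_integral_std_normal_id:
  "has_bochner_integral std_normal_distribution (\<lambda>x. x) 0"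
  using std_normal_moment_odd[of 0]
  by (simp add: has_bochner_integral_iff integrable_normal_law_iff integral_normal_law)

text \<open>Up to a constant the exponential is the likelihood ratio of a shift by \<open>c\<close>
  at unit noise, whose mean is 1.\<close>

lemma has_bochner_integral_std_normal_exp:
  "has_bochner_integral std_normal_distribution (\<lambda>x. exp (c * x)) (exp (c\<^sup>2 / 2))"
proof -
  have "has_bochner_integral std_normal_distribution (\<lambda>x. exp (c\<^sup>2 / 2) * normal_lr 1 c x) (exp (c\<^sup>2 / 2) * 1)"
    by (intro has_bochner_integral_mult_right has_bochner_integral_normal_lr) simp
  moreover have "exp (c\<^sup>2 / 2) * normal_lr 1 c x = exp (c * x)" for x
    by (simp add: normal_lr_def flip: exp_add)
  ultimately show ?thesis by simp
qed

lemma has_bochner_integral_shift_power2: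
  "has_bochner_integral std_normal_distribution (\<lambda>x. (t + x)\<^sup>2) (t\<^sup>2 + 1)"
proof -
  have "has_bochner_integral std_normal_distribution (\<lambda>x. t\<^sup>2 + 2 * t * x + x\<^sup>2) (t\<^sup>2 + 2 * t * 0 + 1)"
    using std_normal.prob_space
    by (intro has_bochner_integral_add has_bochner_integral_mult_right
        has_bochner_integral_std_normal_power2 has_bochner_integral_std_normal_id)
       (auto simp: has_bochner_integral_iff)
  then show ?thesis by (simp add: power2_sum algebra_simps)
qed

lemma integral_std_normal_reflect:
  fixes f :: "real \<Rightarrow> real"
  assumes [measurable]: "f \<in> borel_measurable borel"
  shows "(\<integral>x. f (- x) \<partial>std_normal_distribution) = (\<integral>x. f x \<partial>std_normal_distribution)"
proof -
  have "(\<integral>x. f x \<partial>std_normal_distribution) = (\<integral>x. std_normal_density x * f x \<partial>lborel)"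
    by (rule integral_normal_law) simp
  also have "\<dots> = (\<integral>x. std_normal_density (- x) * f (- x) \<partial>lborel)"
    using lborel_integral_real_affine[of "-1" "\<lambda>x. std_normal_density x * f x" 0] by simp
  also have "\<dots> = (\<integral>x. f (- x) \<partial>std_normal_distribution)"
    by (subst integral_normal_law) (auto simp: normal_density_def)
  finally show ?thesis by simp
qed

text \<open>
  Soft rather than hard thresholding makes this function convex. As it is also even, averaging over
  \<open>x\<close> and \<open>-x\<close> shows that a shift can only increase its Gaussian mean (\<open>shift_mean_soft_mono\<close>).
\<close>

definition soft_square :: "real \<Rightarrow> real \<Rightarrow> real" where
  "soft_square \<tau> x = (max (\<bar>x\<bar> - \<tau>) 0)\<^sup>2"

lemma soft_square_measurable [measurable]: "soft_square \<tau> \<in> borel_measurable borel"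
  unfolding soft_square_def by measurable

lemma soft_square_zero: "soft_square 0 x = x\<^sup>2"
  by (simp add: soft_square_def)

lemma soft_square_uminus: "soft_square \<tau> (- x) = soft_square \<tau> x"
  by (simp add: soft_square_def)

lemma soft_square_le: "\<tau> \<ge> 0 \<Longrightarrow> soft_square \<tau> x \<le> x\<^sup>2"
  unfolding soft_square_def
  by (metis abs_ge_zero diff_ge_0_iff_ge diff_le_eq le_add_same_cancel1 max.bounded_iff max.cobounded2 power2_abs power_mono)

lemma soft_square_ge: "\<tau> \<ge> 0 \<Longrightarrow> x\<^sup>2 / 2 - \<tau>\<^sup>2 \<le> soft_square \<tau> x"
proof -
  assume "\<tau> \<ge> 0"
  define m where "m = max (\<bar>x\<bar> - \<tau>) 0"
  have "\<bar>x\<bar> \<le> m + \<tau>" by (auto simp: m_def)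
  then have "\<bar>x\<bar>\<^sup>2 \<le> (m + \<tau>)\<^sup>2" by (intro power_mono) auto
  also have "\<dots> \<le> 2 * m\<^sup>2 + 2 * \<tau>\<^sup>2"
    using zero_le_power2[of "m - \<tau>"] by (simp add: power2_eq_square algebra_simps)
  finally show ?thesis by (simp add: soft_square_def m_def)
qed

text \<open>\<open>x\<close> is the midpoint of \<open>x + t\<close> and \<open>x - t\<close>, the
  function is convex, and evenness turns \<open>x - t\<close> into \<open>t - x\<close>.\<close>

lemma soft_square_midpoint: "soft_square \<tau> x \<le> (soft_square \<tau> (t + x) + soft_square \<tau> (t - x)) / 2"
proof -
  define a b c where "a = max (\<bar>x\<bar> - \<tau>) 0" and "b = max (\<bar>t + x\<bar> - \<tau>) 0" and "c = max (\<bar>t - x\<bar> - \<tau>) 0"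
  have "0 \<le> a" "a \<le> (b + c) / 2" by (auto simp: a_def b_def c_def max_def)
  then have "a\<^sup>2 \<le> ((b + c) / 2)\<^sup>2" by (intro power_mono) auto
  also have "\<dots> \<le> (b\<^sup>2 + c\<^sup>2) / 2"
    using zero_le_power2[of "b - c"] by (simp add: power2_eq_square field_simps)
  finally show ?thesis by (simp add: soft_square_def a_def b_def c_def)
qed

text \<open>The root of the soft square is 1-Lipschitz and at most \<open>\<bar>t\<bar>\<close> at
  \<open>t\<close>. Factoring the difference of squares keeps the growth in \<open>t\<close>
  quadratic and the bound free of \<open>\<tau>\<close>, so the variance grows at most like the
  squared signal.\<close>

lemma soft_square_diff_le:
  assumes "\<tau> \<ge> 0"
  shows "(soft_square \<tau> (t + x) - soft_square \<tau> t)\<^sup>2 \<le> 8 * t\<^sup>2 * x\<^sup>2 + 2 * x ^ 4"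
proof -
  define a b where "a = max (\<bar>t + x\<bar> - \<tau>) 0" and "b = max (\<bar>t\<bar> - \<tau>) 0"
  have ab: "\<bar>a - b\<bar> \<le> \<bar>x\<bar>" "0 \<le> a" "0 \<le> b" "b \<le> \<bar>t\<bar>" using assms by (auto simp: a_def b_def max_def)
  have "\<bar>a\<^sup>2 - b\<^sup>2\<bar> = \<bar>a - b\<bar> * (a + b)"
    using ab by (simp add: power2_eq_square square_diff_square_factored abs_mult mult.commute)
  also have "\<dots> \<le> \<bar>x\<bar> * (2 * \<bar>t\<bar> + \<bar>x\<bar>)"
    using ab by (intro mult_mono) auto
  finally have "\<bar>a\<^sup>2 - b\<^sup>2\<bar>\<^sup>2 \<le> (\<bar>x\<bar> * (2 * \<bar>t\<bar> + \<bar>x\<bar>))\<^sup>2" by (intro power_mono) auto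
  also have "\<dots> = x\<^sup>2 * (2 * \<bar>t\<bar> + \<bar>x\<bar>)\<^sup>2" by (simp add: power_mult_distrib)
  also have "\<dots> \<le> x\<^sup>2 * (2 * (2 * \<bar>t\<bar>)\<^sup>2 + 2 * \<bar>x\<bar>\<^sup>2)"
    using zero_le_power2[of "2 * \<bar>t\<bar> - \<bar>x\<bar>"] by (intro mult_left_mono) (auto simp: power2_eq_square algebra_simps)
  also have "\<dots> = 8 * t\<^sup>2 * x\<^sup>2 + 2 * x ^ 4" by (simp add: algebra_simps power2_eq_square power4_eq_xxxx)
  finally show ?thesis by (simp add: soft_square_def a_def b_def)
qed

section \<open>Gaussian mean and variance of the soft square\<close>

context
  fixes \<tau> :: real
  assumes \<tau>: "\<tau> \<ge> 0"
begin

lemma has_bochner_integral_soft_bound: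
  "has_bochner_integral std_normal_distribution (\<lambda>x. 8 * t\<^sup>2 * x\<^sup>2 + 2 * x ^ 4) (8 * t\<^sup>2 + 6)"
proof -
  have "has_bochner_integral std_normal_distribution (\<lambda>x. 8 * t\<^sup>2 * x\<^sup>2 + 2 * x ^ 4) (8 * t\<^sup>2 * 1 + 2 * 3)"
    by (intro has_bochner_integral_add has_bochner_integral_mult_right
        has_bochner_integral_std_normal_power2 has_bochner_integral_std_normal_power4)
  then show ?thesis by simp
qed

lemma integrable_soft_square_diff:
  "integrable std_normal_distribution (\<lambda>x. (soft_square \<tau> (t + x) - soft_square \<tau> t)\<^sup>2)"
proof (rule Bochner_Integration.integrable_bound)
  show "integrable std_normal_distribution (\<lambda>x. 8 * t\<^sup>2 * x\<^sup>2 + 2 * x ^ 4)"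
    by (rule has_bochner_integral_soft_bound[unfolded has_bochner_integral_iff, THEN conjunct1])
  show "AE x in std_normal_distribution. norm ((soft_square \<tau> (t + x) - soft_square \<tau> t)\<^sup>2)
      \<le> norm (8 * t\<^sup>2 * x\<^sup>2 + 2 * x ^ 4)"
    using order_trans[OF soft_square_diff_le[OF \<tau>] abs_ge_self] by (intro AE_I2) simp
qed simp

lemma integrable_soft_square_power2:
  "integrable std_normal_distribution (\<lambda>x. (soft_square \<tau> (t + x))\<^sup>2)"
proof (rule Bochner_Integration.integrable_bound)
  show "integrable std_normal_distribution
      (\<lambda>x. 2 * (soft_square \<tau> (t + x) - soft_square \<tau> t)\<^sup>2 + 2 * (soft_square \<tau> t)\<^sup>2)"
    using integrable_soft_square_diff[of t] by simp
  have "a\<^sup>2 \<le> 2 * (a - b)\<^sup>2 + 2 * b\<^sup>2" for a b :: real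
    using zero_le_power2[of "a - 2 * b"] by (simp add: power2_eq_square algebra_simps)
  then show "AE x in std_normal_distribution. norm ((soft_square \<tau> (t + x))\<^sup>2)
      \<le> norm (2 * (soft_square \<tau> (t + x) - soft_square \<tau> t)\<^sup>2 + 2 * (soft_square \<tau> t)\<^sup>2)"
    by simp
qed simp

lemma integrable_soft_square:
  "integrable std_normal_distribution (\<lambda>x. soft_square \<tau> (t + x))"
  by (rule std_normal.square_integrable_imp_integrable[OF _ integrable_soft_square_power2]) simp

text \<open>The variance is the least second moment about any centre. The centres used later are the
  noiseless value \<open>soft_square \<tau> t\<close> and 0.\<close>

lemma shift_var_soft_le_moment:
  "shift_var (soft_square \<tau>) t \<le> (\<integral>x. (soft_square \<tau> (t + x) - c)\<^sup>2 \<partial>std_normal_distribution)"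
proof -
  let ?m = "shift_mean (soft_square \<tau>) t"
  have *: "(soft_square \<tau> (t + x) - c)\<^sup>2
      = (soft_square \<tau> (t + x))\<^sup>2 - 2 * c * soft_square \<tau> (t + x) + c\<^sup>2" for c x
    by (simp add: power2_eq_square algebra_simps)
  have I: "(\<integral>x. (soft_square \<tau> (t + x) - c)\<^sup>2 \<partial>std_normal_distribution)
      = (\<integral>x. (soft_square \<tau> (t + x))\<^sup>2 \<partial>std_normal_distribution) - 2 * c * ?m + c\<^sup>2" for c
    unfolding * using integrable_soft_square[of t] integrable_soft_square_power2[of t] std_normal.prob_space
    by (simp add: shift_mean_def)
  show ?thesis
    unfolding shift_var_def I using zero_le_power2[of "c - ?m"]
    by (simp add: power2_eq_square algebra_simps)
qed

lemma shift_var_soft_le: "shift_var (soft_square \<tau>) t \<le> 8 * t\<^sup>2 + 6"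
proof -
  have "shift_var (soft_square \<tau>) t \<le> (\<integral>x. 8 * t\<^sup>2 * x\<^sup>2 + 2 * x ^ 4 \<partial>std_normal_distribution)"
    using has_bochner_integral_soft_bound[of t] soft_square_diff_le[OF \<tau>, of t] integrable_soft_square_diff[of t]
    by (intro order_trans[OF shift_var_soft_le_moment integral_mono]) (auto simp: has_bochner_integral_iff)
  then show ?thesis using has_bochner_integral_soft_bound[of t] by (simp add: has_bochner_integral_iff)
qed

lemma shift_mean_soft_mono: "shift_mean (soft_square \<tau>) 0 \<le> shift_mean (soft_square \<tau>) t"
proof -
  have refl: "(\<integral>x. soft_square \<tau> (t - x) \<partial>std_normal_distribution) = shift_mean (soft_square \<tau>) t"
    using integral_std_normal_reflect[of "\<lambda>x. soft_square \<tau> (t + x)"] by (simp add: shift_mean_def)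
  have int: "integrable std_normal_distribution (\<lambda>x. soft_square \<tau> (t - x))"
    using integrable_soft_square[of "- t"] soft_square_uminus[of \<tau> "t - x" for x] by simp
  have "shift_mean (soft_square \<tau>) 0
      \<le> (\<integral>x. (soft_square \<tau> (t + x) + soft_square \<tau> (t - x)) / 2 \<partial>std_normal_distribution)"
    unfolding shift_mean_def
    using integrable_soft_square[of t] integrable_soft_square[of 0] int soft_square_midpoint
    by (intro integral_mono) auto
  also have "\<dots> = shift_mean (soft_square \<tau>) t"
    using integrable_soft_square[of t] int refl by (simp add: shift_mean_def)
  finally show ?thesis .
qed

text \<open>Half of the squared shift survives the thresholding up to \<open>\<tau>\<^sup>2\<close>,
  and the mean without shift is at most the second moment 1 of the noise.\<close>

lemma shift_mean_soft_ge:
  "t\<^sup>2 / 2 - \<tau>\<^sup>2 - 1 \<le> shift_mean (soft_square \<tau>) t - shift_mean (soft_square \<tau>) 0"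
proof -
  note H = has_bochner_integral_shift_power2[unfolded has_bochner_integral_iff]
  have "(\<integral>x. (t + x)\<^sup>2 / 2 - \<tau>\<^sup>2 \<partial>std_normal_distribution) \<le> shift_mean (soft_square \<tau>) t"
    unfolding shift_mean_def using H[of t] integrable_soft_square[of t] soft_square_ge[OF \<tau>]
    by (intro integral_mono) auto
  moreover have "(\<integral>x. (t + x)\<^sup>2 / 2 - \<tau>\<^sup>2 \<partial>std_normal_distribution) = (t\<^sup>2 + 1) / 2 - \<tau>\<^sup>2"
    using H[of t] std_normal.prob_space by simp
  moreover have "shift_mean (soft_square \<tau>) 0 \<le> (\<integral>x. (0 + x)\<^sup>2 \<partial>std_normal_distribution)"
    unfolding shift_mean_def using H[of 0] integrable_soft_square[of 0] soft_square_le[OF \<tau>]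
    by (intro integral_mono) auto
  ultimately show ?thesis using H[of 0] by (simp add: add_divide_distrib)
qed

end

lemma shift_mean_square: "shift_mean (soft_square 0) t = t\<^sup>2 + 1"
  using has_bochner_integral_shift_power2[of t]
  by (simp add: shift_mean_def soft_square_zero has_bochner_integral_iff)

text \<open>With \<open>\<bar>t\<bar> \<le> l\<close> the threshold \<open>3 * l\<close> is passed
  only when the noise exceeds \<open>2 * l\<close>. Bounding the fourth power of the excess by an
  exponential with rate \<open>2 * l\<close> gives \<open>exp (- 4 * l\<^sup>2)\<close> times an
  exponential moment of at most \<open>2 * exp (2 * l\<^sup>2)\<close>; the factor 3 is
  \<open>24 * 2 / 16\<close>.\<close>

lemma shift_var_soft_small:
  assumes l: "l > 0" and t: "\<bar>t\<bar> \<le> l"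
  shows "shift_var (soft_square (3 * l)) t \<le> 3 / l ^ 4 * exp (- 2 * l\<^sup>2)"
proof -
  have \<tau>: "3 * l \<ge> 0" using l by simp
  define h where "h x = 24 / (2 * l) ^ 4 * exp (- 4 * l\<^sup>2) * (exp (2 * l * x) + exp (- 2 * l * x))" for x
  have h: "has_bochner_integral std_normal_distribution h
      (24 / (2 * l) ^ 4 * exp (- 4 * l\<^sup>2) * (exp ((2 * l)\<^sup>2 / 2) + exp ((- 2 * l)\<^sup>2 / 2)))"
    unfolding h_def[abs_def]
    by (intro has_bochner_integral_mult_right has_bochner_integral_add has_bochner_integral_std_normal_exp)
  have le: "(soft_square (3 * l) (t + x))\<^sup>2 \<le> h x" for x
  proof -
    define u where "u = max (\<bar>x\<bar> - 2 * l) 0"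
    have "max (\<bar>t + x\<bar> - 3 * l) 0 \<le> u" using t by (auto simp: u_def)
    then have "(max (\<bar>t + x\<bar> - 3 * l) 0) ^ 4 \<le> u ^ 4" by (intro power_mono) auto
    then have 1: "(soft_square (3 * l) (t + x))\<^sup>2 \<le> u ^ 4"
      by (simp add: soft_square_def flip: power_mult)
    show ?thesis
    proof (cases "u = 0")
      case True
      have "0 \<le> h x" using l by (simp add: h_def)
      with 1 True show ?thesis by simp
    next
      case False
      then have u: "u = \<bar>x\<bar> - 2 * l" "u > 0" by (auto simp: u_def max_def split: if_splits)
      have "(2 * l * u) ^ 4 / fact 4 \<le> exp (2 * l * u)"
      proof -
        have "(\<lambda>n. (2 * l * u) ^ n / fact n) sums exp (2 * l * u)"
          using exp_converges[of "2 * l * u"] by (simp add: divide_inverse mult.commute)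
        then have "summable (\<lambda>n. (2 * l * u) ^ n / fact n)" "(\<Sum>n. (2 * l * u) ^ n / fact n) = exp (2 * l * u)"
          by (auto simp: sums_iff)
        moreover have "0 \<le> (2 * l * u) ^ n / fact n" for n using l u by simp
        ultimately show ?thesis
          using sum_le_suminf[of "\<lambda>n. (2 * l * u) ^ n / fact n" "{4}"] by (simp only: sum.insert) simp
      qed
      then have "u ^ 4 \<le> 24 / (2 * l) ^ 4 * exp (2 * l * u)"
        using l by (simp add: fact_numeral power_mult_distrib field_simps)
      also have "exp (2 * l * u) = exp (- 4 * l\<^sup>2) * exp (2 * l * \<bar>x\<bar>)"
        by (simp add: u power2_eq_square algebra_simps flip: exp_add)
      also have "24 / (2 * l) ^ 4 * (exp (- 4 * l\<^sup>2) * exp (2 * l * \<bar>x\<bar>))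
          \<le> 24 / (2 * l) ^ 4 * (exp (- 4 * l\<^sup>2) * (exp (2 * l * x) + exp (- 2 * l * x)))"
        using l by (intro mult_left_mono) (auto simp: abs_if)
      finally have "u ^ 4 \<le> h x" by (simp add: h_def)
      with 1 show ?thesis by simp
    qed
  qed
  have "shift_var (soft_square (3 * l)) t \<le> (\<integral>x. (soft_square (3 * l) (t + x) - 0)\<^sup>2 \<partial>std_normal_distribution)"
    by (rule shift_var_soft_le_moment[OF \<tau>])
  also have "\<dots> \<le> (\<integral>x. h x \<partial>std_normal_distribution)"
  proof (rule integral_mono)
    show "integrable std_normal_distribution (\<lambda>x. (soft_square (3 * l) (t + x) - 0)\<^sup>2)"
      using integrable_soft_square_power2[OF \<tau>, of t] by simp
    show "integrable std_normal_distribution h"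
      using h by (rule has_bochner_integral_iff[THEN iffD1, THEN conjunct1])
    show "(soft_square (3 * l) (t + x) - 0)\<^sup>2 \<le> h x" for x
      using le[of x] by simp
  qed
  also have "\<dots> = 24 / (2 * l) ^ 4 * exp (- 4 * l\<^sup>2) * (2 * exp (2 * l\<^sup>2))"
  proof -
    have sq: "(2 * l)\<^sup>2 / 2 = 2 * l\<^sup>2" "(- 2 * l)\<^sup>2 / 2 = 2 * l\<^sup>2"
      by (simp_all add: power2_eq_square)
    show ?thesis
      unfolding has_bochner_integral_integral_eq[OF h] sq by (simp only: mult_2)
  qed
  also have "\<dots> = 3 / l ^ 4 * (exp (- 4 * l\<^sup>2) * exp (2 * l\<^sup>2))"
  proof -
    have "24 / (2 * l) ^ 4 * a * (2 * b) = 3 / l ^ 4 * (a * b)" for a b :: real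
      by (simp add: power_mult_distrib)
    then show ?thesis .
  qed
  also have "exp (- 4 * l\<^sup>2) * exp (2 * l\<^sup>2) = exp (- 2 * l\<^sup>2)"
    by (simp flip: exp_add)
  finally show ?thesis .
qed

text \<open>The chi-square test, with threshold 0. If \<open>W\<close> is the sum of the squares of
  \<open>\<theta> j / \<sigma>\<close>, the mean shift is exactly \<open>W\<close> and the variance
  at most \<open>8 * W + 6 * d\<close>; half of the shift is kept as the margin. The constant 112
  makes both variance terms small against \<open>\<epsilon> * W\<^sup>2\<close>.\<close>

lemma testing_risk_le_dense:
  assumes \<sigma>: "\<sigma> > 0" and \<epsilon>: "0 < \<epsilon>" "\<epsilon> < 1" and d: "d \<ge> 1"
    and alt: "\<And>\<theta>. \<theta> \<in> alternative_set d q u \<delta> \<Longrightarrow> 112 / \<epsilon> * \<sigma>\<^sup>2 * sqrt (real d) \<le> (\<Sum>j\<in>{1..d}. (\<theta> j)\<^sup>2)"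
  shows "testing_risk d \<sigma> q u \<delta> \<le> ennreal \<epsilon>"
proof (rule testing_risk_le[OF \<sigma> \<epsilon>(1), where \<phi> = "soft_square 0" and K = "12 / \<epsilon> * sqrt (real d)"])
  show "12 / \<epsilon> * sqrt (real d) > 0" using \<epsilon> d by simp
  show "integrable std_normal_distribution (\<lambda>x. (soft_square 0 (t + x))\<^sup>2)" for t
    by (rule integrable_soft_square_power2) simp
  have "real d * shift_var (soft_square 0) 0 \<le> real d * 6"
    using shift_var_soft_le[of 0 0] by (intro mult_left_mono) auto
  also have "\<dots> \<le> real d * (72 / \<epsilon>)"
    using \<epsilon> by (intro mult_left_mono) (auto simp: le_divide_eq)
  also have "\<dots> = \<epsilon> / 2 * (12 / \<epsilon> * sqrt (real d))\<^sup>2"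
    using \<epsilon> by (simp add: power_mult_distrib power_divide power2_eq_square field_simps)
  finally show "real d * shift_var (soft_square 0) 0 \<le> \<epsilon> / 2 * (12 / \<epsilon> * sqrt (real d))\<^sup>2" .
  fix \<theta> assume \<theta>: "\<theta> \<in> alternative_set d q u \<delta>"
  define W where "W = (\<Sum>j\<in>{1..d}. (\<theta> j / \<sigma>)\<^sup>2)"
  have "W = (\<Sum>j\<in>{1..d}. (\<theta> j)\<^sup>2) / \<sigma>\<^sup>2"
    by (simp add: W_def power_divide sum_divide_distrib)
  then have W: "112 / \<epsilon> * sqrt (real d) \<le> W"
    using alt[OF \<theta>] \<sigma> by (simp add: le_divide_eq mult_ac)
  have sqrt_d: "1 \<le> sqrt (real d)" using d by simp
  have W': "112 * sqrt (real d) \<le> \<epsilon> * W" using W \<epsilon> by (simp add: field_simps)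
  then have W1: "112 \<le> \<epsilon> * W" using sqrt_d by linarith
  have W0: "W > 0" by (rule zero_less_mult_pos[OF less_le_trans[OF _ W1] \<epsilon>(1)]) simp
  from W' have "(112 * sqrt (real d))\<^sup>2 \<le> (\<epsilon> * W)\<^sup>2" by (intro power_mono) auto
  then have "12544 * real d \<le> \<epsilon> * (\<epsilon> * W\<^sup>2)"
    by (simp add: power_mult_distrib) (simp add: power2_eq_square mult_ac)
  also have "\<dots> \<le> 1 * (\<epsilon> * W\<^sup>2)" using \<epsilon> by (intro mult_right_mono) auto
  finally have dW: "12544 * real d \<le> \<epsilon> * W\<^sup>2" by simp
  have WW: "112 * W \<le> \<epsilon> * W\<^sup>2"
    using mult_right_mono[OF W1, of W] W0 by (simp add: power2_eq_square mult_ac)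
  have "(\<Sum>j\<in>{1..d}. shift_mean (soft_square 0) (\<theta> j / \<sigma>) - shift_mean (soft_square 0) 0) = W"
    by (simp add: shift_mean_square W_def)
  moreover have "12 / \<epsilon> * sqrt (real d) + W / 2 \<le> W"
  proof -
    have "24 * sqrt (real d) \<le> \<epsilon> * W" using W' sqrt_d by linarith
    then show ?thesis using \<epsilon> by (simp add: field_simps)
  qed
  moreover have "(\<Sum>j\<in>{1..d}. shift_var (soft_square 0) (\<theta> j / \<sigma>)) \<le> \<epsilon> / 2 * (W / 2)\<^sup>2"
  proof -
    have "(\<Sum>j\<in>{1..d}. shift_var (soft_square 0) (\<theta> j / \<sigma>)) \<le> (\<Sum>j\<in>{1..d}. 8 * (\<theta> j / \<sigma>)\<^sup>2 + 6)"
      by (intro sum_mono shift_var_soft_le) simp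
    also have "\<dots> = 8 * W + 6 * real d"
      by (simp add: W_def sum.distrib sum_distrib_left)
    also have "\<dots> \<le> \<epsilon> / 2 * (W / 2)\<^sup>2" using WW dW by (simp add: power_divide)
    finally show ?thesis .
  qed
  ultimately show "\<exists>D>0. 12 / \<epsilon> * sqrt (real d) + D
        \<le> (\<Sum>j\<in>{1..d}. shift_mean (soft_square 0) (\<theta> j / \<sigma>) - shift_mean (soft_square 0) 0)
      \<and> (\<Sum>j\<in>{1..d}. shift_var (soft_square 0) (\<theta> j / \<sigma>)) \<le> \<epsilon> / 2 * D\<^sup>2"
    using W0 by (intro exI[of _ "W / 2"]) simp
qed simp

text \<open>Here \<open>d / s\<^sup>2\<close> is at least 1, hence the logarithm at least
  \<open>ln 2\<close>. Additive constants can thus be absorbed into the logarithm.\<close>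

lemma sparsity_log_ge_half:
  assumes "1 \<le> s" "real s \<le> sqrt (real d)"
  shows "1 / 2 \<le> sparsity_log d s"
proof -
  have "(real s)\<^sup>2 \<le> real d"
    using assms by (metis of_nat_0_le_iff real_sqrt_le_iff real_sqrt_unique)
  then have "1 \<le> real d / (real s)\<^sup>2" using assms by (simp add: le_divide_eq)
  then have "ln 2 \<le> sparsity_log d s" unfolding sparsity_log_def by (intro ln_mono) auto
  then show ?thesis using ln2_ge_two_thirds by linarith
qed

lemma testing_risk_le_sparse:
  assumes \<sigma>: "\<sigma> > 0" and \<epsilon>: "0 < \<epsilon>" "\<epsilon> < 1" and s: "1 \<le> s" "real s \<le> sqrt (real d)"
  defines "L \<equiv> sparsity_log d s"
  defines "B \<equiv> \<lambda>\<theta>. {j\<in>{1..d}. \<sigma> * sqrt L < \<bar>\<theta> j\<bar>}"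
  assumes alt: "\<And>\<theta>. \<theta> \<in> alternative_set d q u \<delta> \<Longrightarrow>
      card (B \<theta>) \<le> s \<and> 4000 / \<epsilon> * \<sigma>\<^sup>2 * (real s * L) \<le> (\<Sum>j\<in>B \<theta>. (\<theta> j)\<^sup>2)"
  shows "testing_risk d \<sigma> q u \<delta> \<le> ennreal \<epsilon>"
proof -
  define \<phi> where "\<phi> = soft_square (3 * sqrt L)"
  define P where "P = real s * L"
  have L: "1 / 2 \<le> L" unfolding L_def using s by (rule sparsity_log_ge_half)
  have d: "real d \<ge> 1"
  proof -
    have "1 \<le> sqrt (real d)" using s by linarith
    then show ?thesis by simp
  qed
  have \<tau>: "3 * sqrt L \<ge> 0" using L by simp
  have sP: "real s \<le> 2 * P" using L s mult_left_mono[OF L, of "real s"] by (simp add: P_def)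
  have P: "1 / 2 \<le> P" using sP s by linarith
  have sP2: "(real s)\<^sup>2 \<le> 4 * P\<^sup>2"
    using power_mono[OF sP, of 2] by (simp add: power_mult_distrib)
  \<comment> \<open>The tail \<open>exp (- 2 * L)\<close> is at most \<open>exp (- L)\<close>, the
    reciprocal of \<open>1 + d / s\<^sup>2\<close>. Summed over at most \<open>d\<close> coordinates
    the variance is of order \<open>s\<^sup>2\<close>, hence at most of the order of the squared
    critical value.\<close>
  have small: "shift_var \<phi> t \<le> 12 * (real s)\<^sup>2 / d" if "\<bar>t\<bar> \<le> sqrt L" for t
  proof -
    have "shift_var \<phi> t \<le> 3 / sqrt L ^ 4 * exp (- 2 * (sqrt L)\<^sup>2)"
      unfolding \<phi>_def using L that by (intro shift_var_soft_small) auto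
    also have "\<dots> = 3 / L\<^sup>2 * exp (- 2 * L)"
    proof -
      have "sqrt L ^ 4 = ((sqrt L)\<^sup>2)\<^sup>2" by (simp flip: power_mult)
      then show ?thesis using L by simp
    qed
    also have "\<dots> \<le> 12 * ((real s)\<^sup>2 / d)"
    proof (rule mult_mono)
      have "(1 / 2)\<^sup>2 \<le> L\<^sup>2" using L by (intro power_mono) auto
      then show "3 / L\<^sup>2 \<le> 12" using L by (simp add: divide_le_eq power_divide)
      have "exp (- 2 * L) \<le> exp (- L)" using L by simp
      also have "\<dots> = inverse (1 + real d / (real s)\<^sup>2)"
        unfolding L_def sparsity_log_def by (simp add: exp_minus add_pos_nonneg)
      also have "\<dots> \<le> inverse (real d / (real s)\<^sup>2)"
        using d s by (intro le_imp_inverse_le) auto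
      finally show "exp (- 2 * L) \<le> (real s)\<^sup>2 / d" by simp
    qed auto
    finally show ?thesis by simp
  qed
  show ?thesis
  proof (rule testing_risk_le[OF \<sigma> \<epsilon>(1), where \<phi> = \<phi> and K = "96 / \<epsilon> * P"])
    show "96 / \<epsilon> * P > 0" using \<epsilon> P by simp
    show "\<phi> \<in> borel_measurable borel" by (simp add: \<phi>_def)
    show "integrable std_normal_distribution (\<lambda>x. (\<phi> (t + x))\<^sup>2)" for t
      unfolding \<phi>_def by (rule integrable_soft_square_power2[OF \<tau>])
    have "real d * shift_var \<phi> 0 \<le> real d * (12 * (real s)\<^sup>2 / d)"
      using small[of 0] L by (intro mult_left_mono) auto
    also have "\<dots> \<le> 48 * P\<^sup>2" using sP2 d by simp
    also have "\<dots> \<le> 4608 / \<epsilon> * P\<^sup>2"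
      using \<epsilon> by (intro mult_right_mono) (auto simp: le_divide_eq)
    also have "\<dots> = \<epsilon> / 2 * (96 / \<epsilon> * P)\<^sup>2"
      using \<epsilon> by (simp add: power_mult_distrib power_divide power2_eq_square field_simps)
    finally show "real d * shift_var \<phi> 0 \<le> \<epsilon> / 2 * (96 / \<epsilon> * P)\<^sup>2" .
    fix \<theta> assume \<theta>: "\<theta> \<in> alternative_set d q u \<delta>"
    have B: "B \<theta> \<subseteq> {1..d}" "finite (B \<theta>)" by (auto simp: B_def)
    define W where "W = (\<Sum>j\<in>B \<theta>. (\<theta> j / \<sigma>)\<^sup>2)"
    have "W = (\<Sum>j\<in>B \<theta>. (\<theta> j)\<^sup>2) / \<sigma>\<^sup>2"
      by (simp add: W_def power_divide sum_divide_distrib)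
    then have W: "4000 / \<epsilon> * P \<le> W"
      using alt[OF \<theta>] \<sigma> by (simp add: le_divide_eq mult_ac P_def)
    have card: "real (card (B \<theta>)) \<le> real s" using alt[OF \<theta>] by simp
    have PW: "4000 * P \<le> \<epsilon> * W" using W \<epsilon> by (simp add: field_simps)
    have W1: "2000 \<le> \<epsilon> * W" using PW P by linarith
    have W0: "W > 0" by (rule zero_less_mult_pos[OF less_le_trans[OF _ W1] \<epsilon>(1)]) simp
    have WW: "2000 * W \<le> \<epsilon> * W\<^sup>2"
      using mult_right_mono[OF W1, of W] W0 by (simp add: power2_eq_square mult_ac)
    have eW: "\<epsilon> * W \<le> W" using \<epsilon> W0 by simp
    have PP: "4000 * P\<^sup>2 \<le> \<epsilon> * W\<^sup>2"
    proof -
      have "P \<le> W" "0 \<le> P" "0 \<le> \<epsilon> * W" using PW P eW by linarith+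
      then have "4000 * P * P \<le> \<epsilon> * W * W"
        by (intro mult_mono[OF PW])
      then show ?thesis by (simp add: power2_eq_square mult_ac)
    qed
    \<comment> \<open>A coordinate in \<open>B \<theta>\<close> loses at most
      \<open>9 * L + 1 \<le> 11 * L\<close> to the thresholding and the centring; there are at most
      \<open>s\<close> of them, and the others cannot lower the sum.\<close>
    have gain: "W / 2 - 11 * P \<le> (\<Sum>j\<in>{1..d}. shift_mean \<phi> (\<theta> j / \<sigma>) - shift_mean \<phi> 0)"
    proof -
      have "W / 2 - 11 * P \<le> W / 2 - real (card (B \<theta>)) * (11 * L)"
        using mult_right_mono[OF card, of "11 * L"] L by (simp add: P_def)
      also have "\<dots> = (\<Sum>j\<in>B \<theta>. (\<theta> j / \<sigma>)\<^sup>2 / 2 - 11 * L)"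
        by (simp add: W_def sum_subtractf sum_divide_distrib)
      also have "\<dots> \<le> (\<Sum>j\<in>B \<theta>. shift_mean \<phi> (\<theta> j / \<sigma>) - shift_mean \<phi> 0)"
      proof (rule sum_mono)
        fix j
        have "(\<theta> j / \<sigma>)\<^sup>2 / 2 - 11 * L \<le> (\<theta> j / \<sigma>)\<^sup>2 / 2 - (3 * sqrt L)\<^sup>2 - 1"
          using L by (simp add: power_mult_distrib)
        also have "\<dots> \<le> shift_mean \<phi> (\<theta> j / \<sigma>) - shift_mean \<phi> 0"
          unfolding \<phi>_def by (rule shift_mean_soft_ge[OF \<tau>])
        finally show "(\<theta> j / \<sigma>)\<^sup>2 / 2 - 11 * L \<le> shift_mean \<phi> (\<theta> j / \<sigma>) - shift_mean \<phi> 0" .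
      qed
      also have "\<dots> \<le> (\<Sum>j\<in>{1..d}. shift_mean \<phi> (\<theta> j / \<sigma>) - shift_mean \<phi> 0)"
        using shift_mean_soft_mono[OF \<tau>] B by (intro sum_mono2) (auto simp: \<phi>_def)
      finally show ?thesis .
    qed
    have "P \<le> P / \<epsilon>" using \<epsilon> P by (simp add: le_divide_eq)
    then have "96 / \<epsilon> * P + W / 4 \<le> W / 2 - 11 * P"
      using W P by simp
    with gain have "96 / \<epsilon> * P + W / 4 \<le> (\<Sum>j\<in>{1..d}. shift_mean \<phi> (\<theta> j / \<sigma>) - shift_mean \<phi> 0)"
      by linarith
    \<comment> \<open>Small coordinates contribute a variance of order \<open>P\<^sup>2\<close> in
      all, large ones \<open>8 * W + 6 * s\<close>. Since \<open>W\<close> is at least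
      \<open>4000 / \<epsilon> * P\<close> and \<open>P\<close> at least 1/2, everything fits into
      \<open>\<epsilon> * W\<^sup>2 / 32\<close>.\<close>
    moreover have "(\<Sum>j\<in>{1..d}. shift_var \<phi> (\<theta> j / \<sigma>)) \<le> \<epsilon> / 2 * (W / 4)\<^sup>2"
    proof -
      have "(\<Sum>j\<in>{1..d}. shift_var \<phi> (\<theta> j / \<sigma>))
          = (\<Sum>j\<in>{1..d} - B \<theta>. shift_var \<phi> (\<theta> j / \<sigma>)) + (\<Sum>j\<in>B \<theta>. shift_var \<phi> (\<theta> j / \<sigma>))"
        by (rule sum.subset_diff[OF B(1)]) simp
      also have "\<dots> \<le> (\<Sum>j\<in>{1..d} - B \<theta>. 12 * (real s)\<^sup>2 / d) + (\<Sum>j\<in>B \<theta>. 8 * (\<theta> j / \<sigma>)\<^sup>2 + 6)"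
      proof (intro add_mono sum_mono)
        fix j assume "j \<in> {1..d} - B \<theta>"
        then show "shift_var \<phi> (\<theta> j / \<sigma>) \<le> 12 * (real s)\<^sup>2 / d"
          using \<sigma> by (intro small) (auto simp: B_def abs_divide divide_le_eq mult.commute)
      next
        show "shift_var \<phi> (\<theta> j / \<sigma>) \<le> 8 * (\<theta> j / \<sigma>)\<^sup>2 + 6" for j
          unfolding \<phi>_def by (rule shift_var_soft_le[OF \<tau>])
      qed
      also have "\<dots> = real (card ({1..d} - B \<theta>)) * (12 * (real s)\<^sup>2 / d) + 8 * W + 6 * real (card (B \<theta>))"
        by (simp add: W_def sum.distrib sum_distrib_left)
      also have "\<dots> \<le> real d * (12 * (real s)\<^sup>2 / d) + 8 * W + 6 * real s"
        using card card_mono[of "{1..d}" "{1..d} - B \<theta>"]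
        by (intro add_mono mult_right_mono mult_left_mono) auto
      also have "\<dots> \<le> 48 * P\<^sup>2 + 8 * W + 12 * P"
        using sP sP2 d by simp
      also have "\<dots> \<le> \<epsilon> * W\<^sup>2 / 32" using PP WW PW eW W0 P by linarith
      also have "\<dots> = \<epsilon> / 2 * (W / 4)\<^sup>2" by (simp add: power_divide)
      finally show ?thesis .
    qed
    ultimately show "\<exists>D>0. 96 / \<epsilon> * P + D \<le> (\<Sum>j\<in>{1..d}. shift_mean \<phi> (\<theta> j / \<sigma>) - shift_mean \<phi> 0)
        \<and> (\<Sum>j\<in>{1..d}. shift_var \<phi> (\<theta> j / \<sigma>)) \<le> \<epsilon> / 2 * D\<^sup>2"
      using W0 by (intro exI[of _ "W / 4"]) simp
  qed
qed

section \<open>Sparsity levels and rates\<close>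

text \<open>Bernoulli's inequality in the form \<open>exp_mult_ln_le\<close>, with
  \<open>p = 1 / c\<close> and argument \<open>c * x\<close>, after taking logarithms.\<close>

lemma ln_one_plus_mult_le:
  fixes c x :: real
  assumes "c \<ge> 1" "x \<ge> 0"
  shows "ln (1 + c * x) \<le> c * ln (1 + x)"
proof -
  have pos: "0 < 1 + x" "0 < 1 + c * x" using assms by (auto intro: add_pos_nonneg)
  have "exp (1 / c * ln (1 + c * x)) \<le> exp (ln (1 + x))"
    using exp_mult_ln_le[of "1 / c" "c * x"] assms pos by simp
  then have "1 / c * ln (1 + c * x) \<le> ln (1 + x)" by (simp only: exp_le_cancel_iff)
  then show ?thesis using assms by (simp add: divide_le_eq mult.commute)
qed

lemma sparsity_levels_iff:
  "s \<in> sparsity_levels \<sigma> q r d \<longleftrightarrow>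
    s \<ge> 1 \<and> \<sigma>\<^sup>2 * sparsity_log d s \<le> r\<^sup>2 * real s powr (- (2 / q))"
  by (simp add: sparsity_levels_def sparsity_log_def)

lemma sparsity_log_nonneg: "sparsity_log d s \<ge> 0"
  by (simp add: sparsity_log_def)

text \<open>For \<open>q \<le> 1\<close> the product of \<open>s powr (2 / q)\<close> and the
  logarithm is nondecreasing in \<open>s\<close>: passing from \<open>s'\<close> down to
  \<open>s\<close> multiplies the logarithm by at most \<open>c\<^sup>2\<close>, which
  \<open>c powr (2 / q)\<close> dominates.\<close>

lemma sparsity_levels_down_closed:
  assumes q: "0 < q" "q \<le> 1" and s': "s' \<in> sparsity_levels \<sigma> q r d" and s: "1 \<le> s" "s \<le> s'"
  shows "s \<in> sparsity_levels \<sigma> q r d"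
proof -
  define c where "c = real s' / real s"
  have c: "c \<ge> 1" using s by (simp add: c_def le_divide_eq)
  have "c\<^sup>2 * (real d / (real s')\<^sup>2) = real d / (real s)\<^sup>2"
    using s by (simp add: c_def power_divide)
  then have "sparsity_log d s \<le> c\<^sup>2 * sparsity_log d s'"
    using ln_one_plus_mult_le[of "c\<^sup>2" "real d / (real s')\<^sup>2"] c
    by (simp add: sparsity_log_def one_le_power)
  also have "c\<^sup>2 = c powr 2" using c by simp
  also have "c powr 2 * sparsity_log d s' \<le> c powr (2 / q) * sparsity_log d s'"
    using c q by (intro mult_right_mono powr_mono sparsity_log_nonneg) (auto simp: le_divide_eq)
  finally have "\<sigma>\<^sup>2 * sparsity_log d s \<le> c powr (2 / q) * (\<sigma>\<^sup>2 * sparsity_log d s')"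
    by (metis mult.left_commute mult_left_mono zero_le_power2)
  also have "\<dots> \<le> c powr (2 / q) * (r\<^sup>2 * real s' powr (- (2 / q)))"
    using s' by (intro mult_left_mono) (auto simp: sparsity_levels_iff)
  also have "\<dots> = r\<^sup>2 * real s powr (- (2 / q))"
    using s by (simp add: c_def powr_divide powr_minus field_simps)
  finally show ?thesis using s by (simp add: sparsity_levels_iff)
qed

text \<open>The logarithm is at most \<open>d / s\<^sup>2\<close>, which decays faster than
  \<open>s powr (- (2 / q))\<close> when \<open>q > 1\<close>, so every large \<open>s\<close>
  qualifies. Used in contrapositive form: a finite set of levels forces
  \<open>q \<le> 1\<close>.\<close>

lemma infinite_sparsity_levels:
  assumes q: "1 < q" and r: "r > 0"
  shows "infinite (sparsity_levels \<sigma> q r d)"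
proof -
  define e where "e = 2 - 2 / q"
  have e: "e > 0" using q by (simp add: e_def field_simps)
  define c where "c = \<sigma>\<^sup>2 * real d / r\<^sup>2"
  have "s \<in> sparsity_levels \<sigma> q r d" if s: "1 \<le> s" "c powr (1 / e) \<le> real s" for s
  proof -
    have "c \<ge> 0" by (simp add: c_def)
    then have "c = (c powr (1 / e)) powr e" using e by (simp add: powr_powr)
    also have "\<dots> \<le> real s powr e" using s e by (intro powr_mono2) auto
    finally have "\<sigma>\<^sup>2 * real d \<le> r\<^sup>2 * real s powr e"
      using r by (simp add: c_def divide_le_eq mult.commute)
    moreover have "real s powr e = (real s)\<^sup>2 * real s powr (- (2 / q))"
      using s by (simp add: e_def powr_diff powr_minus divide_inverse)
    ultimately have "\<sigma>\<^sup>2 * (real d / (real s)\<^sup>2) \<le> r\<^sup>2 * real s powr (- (2 / q))"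
      using s by (simp add: divide_le_eq mult_ac)
    moreover have "\<sigma>\<^sup>2 * sparsity_log d s \<le> \<sigma>\<^sup>2 * (real d / (real s)\<^sup>2)"
      unfolding sparsity_log_def by (intro mult_left_mono ln_add_one_self_le_self) auto
    ultimately show ?thesis using s by (simp add: sparsity_levels_iff)
  qed
  then have "{max 1 (nat \<lceil>c powr (1 / e)\<rceil>)..} \<subseteq> sparsity_levels \<sigma> q r d"
    by (auto simp: nat_ceiling_le_eq)
  then show ?thesis using infinite_Ici finite_subset by blast
qed

text \<open>In the infinite case the value is a supremum over initial segments. If it is finite it
  is attained, so \<open>m + 1\<close> is the first gap; if it is infinite there is no gap.\<close>

lemma effective_sparsity_infinite_case:
  assumes "sparsity_levels \<sigma> q r d = S" "infinite S"
  shows "effective_sparsity \<sigma> q r d = \<infinity> \<Longrightarrow> s \<ge> 1 \<Longrightarrow> s \<in> S"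
    and "effective_sparsity \<sigma> q r d = enat m \<Longrightarrow> {1..m} \<subseteq> S \<and> m + 1 \<notin> S"
proof -
  define T where "T = {s::nat. {1..s} \<subseteq> S}"
  have eff: "effective_sparsity \<sigma> q r d = (SUP s\<in>T. enat s)"
    using assms by (auto simp: effective_sparsity_def T_def Let_def)
  have down: "t \<in> T" if "t' \<in> T" "t \<le> t'" for t t'
    using that by (auto simp: T_def)
  show "s \<in> S" if "effective_sparsity \<sigma> q r d = \<infinity>" "s \<ge> 1"
  proof (rule ccontr)
    assume "s \<notin> S"
    then have "t \<le> s" if "t \<in> T" for t using that \<open>s \<ge> 1\<close> by (force simp: T_def)
    then have "(SUP s\<in>T. enat s) \<le> enat s" by (intro SUP_least) auto
    with that eff show False by simp
  qed
  assume m: "effective_sparsity \<sigma> q r d = enat m"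
  have ub: "t \<le> m" if "t \<in> T" for t
    using SUP_upper[OF that, of enat] m eff by simp
  have "m \<in> T"
  proof (rule ccontr)
    assume "m \<notin> T"
    with down ub have lt: "t < m" if "t \<in> T" for t using that by (metis le_neq_implies_less)
    \<comment> \<open>\<open>{1..0}\<close> is empty, so 0 always belongs to
      \<open>T\<close>.\<close>
    then have "m > 0" by (force simp: T_def)
    have "(SUP s\<in>T. enat s) \<le> enat (m - 1)" using lt by (intro SUP_least) fastforce
    with \<open>m > 0\<close> m eff show False by simp
  qed
  moreover have "m + 1 \<notin> T" using ub[of "m + 1"] by auto
  ultimately show "{1..m} \<subseteq> S \<and> m + 1 \<notin> S"
    by (auto simp: T_def le_Suc_eq)
qed

text \<open>All conventions about \<open>m\<close> are settled here; the risk bounds use only which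
  levels belong to the set. The case \<open>zero\<close> covers an empty set of levels as well as an
  infinite one that omits 1.\<close>

lemma psi_ball_cases:
  assumes q: "0 < q" "q < 2" and r: "r > 0"
  obtains
    (dense) "psi_ball \<sigma> q r d = \<sigma>\<^sup>2 * sqrt (real d)"
      "\<And>s. 1 \<le> s \<Longrightarrow> real s \<le> sqrt (real d) \<Longrightarrow> s \<in> sparsity_levels \<sigma> q r d"
  | (sparse) m where "psi_ball \<sigma> q r d = \<sigma>\<^sup>2 * (real m * sparsity_log d m)" "1 \<le> m" "real m \<le> sqrt (real d)"
      "m \<in> sparsity_levels \<sigma> q r d" "m + 1 \<notin> sparsity_levels \<sigma> q r d"
  | (zero) "psi_ball \<sigma> q r d = r\<^sup>2" "1 \<notin> sparsity_levels \<sigma> q r d"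
proof -
  define S where "S = sparsity_levels \<sigma> q r d"
  have fin: "thesis" if eff: "effective_sparsity \<sigma> q r d = enat m"
    and m: "m = 0 \<or> m \<in> S" "m + 1 \<notin> S"
    and below: "\<And>s. real m > sqrt (real d) \<Longrightarrow> 1 \<le> s \<Longrightarrow> s \<le> m \<Longrightarrow> s \<in> S" for m
  proof (cases "real m > sqrt (real d)")
    case True
    show thesis
    proof (rule dense)
      show "psi_ball \<sigma> q r d = \<sigma>\<^sup>2 * sqrt (real d)" using True eff by (simp add: psi_ball_def)
      fix s :: nat assume "1 \<le> s" "real s \<le> sqrt (real d)"
      with True show "s \<in> sparsity_levels \<sigma> q r d" using below[of s] by (simp add: S_def)
    qed
  next
    case False
    show thesis
    proof (cases "m = 0")
      case True
      with False eff m show thesis by (intro zero) (auto simp: psi_ball_def S_def)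
    next
      case m0: False
      with False eff m show thesis
        by (intro sparse[of m]) (auto simp: psi_ball_def S_def sparsity_log_def)
    qed
  qed
  consider "S = {}" | "S \<noteq> {}" "finite S" | "infinite S" by blast
  then show thesis
  proof cases
    case 1
    then show thesis
      by (intro fin[of 0]) (auto simp: effective_sparsity_def S_def zero_enat_def)
  next
    case 2
    then have "q \<le> 1" using infinite_sparsity_levels[of q r] r by (force simp: S_def)
    have "Max S \<in> S" using 2 by simp
    moreover have "Max S + 1 \<notin> S" using 2(2) by (metis Max_ge Suc_eq_plus1 not_less_eq_eq order_refl)
    moreover have "s \<in> S" if "1 \<le> s" "s \<le> Max S" for s
      using sparsity_levels_down_closed[OF q(1) \<open>q \<le> 1\<close>, of "Max S"] \<open>Max S \<in> S\<close> that by (simp add: S_def)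
    moreover have "effective_sparsity \<sigma> q r d = enat (Max S)"
      using 2 by (simp add: effective_sparsity_def S_def)
    ultimately show thesis by (intro fin[of "Max S"]) auto
  next
    case 3
    note inf = effective_sparsity_infinite_case[OF S_def[symmetric] 3]
    show thesis
    proof (cases "effective_sparsity \<sigma> q r d")
      case (enat m)
      then have "{1..m} \<subseteq> S" "m + 1 \<notin> S" using inf(2) by auto
      moreover from this have "m = 0 \<or> m \<in> S" by (cases m) auto
      ultimately show thesis using enat by (intro fin[of m]) auto
    next
      case infinity
      show thesis
      proof (rule dense)
        show "psi_ball \<sigma> q r d = \<sigma>\<^sup>2 * sqrt (real d)" using infinity by (simp add: psi_ball_def)
      qed (use inf(1)[OF infinity] in \<open>auto simp: S_def\<close>)
    qed
  qed
qed

section \<open>Norms on the alternative and splitting of vectors by the size of their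
  entries\<close>

lemma lq_norm_2: "lq_norm d 2 \<theta> = sqrt (\<Sum>j\<in>{1..d}. (\<theta> j)\<^sup>2)"
  by (simp add: lq_norm_def powr_half_sqrt sum_nonneg)

lemma alternative_set_sum_square:
  assumes "\<theta> \<in> alternative_set d q u \<delta>" "\<delta> \<ge> 0"
  shows "\<delta>\<^sup>2 \<le> (\<Sum>j\<in>{1..d}. (\<theta> j)\<^sup>2)"
proof -
  have "\<delta> \<le> sqrt (\<Sum>j\<in>{1..d}. (\<theta> j)\<^sup>2)" using assms by (simp add: alternative_set_def lq_norm_2)
  then have "\<delta>\<^sup>2 \<le> (sqrt (\<Sum>j\<in>{1..d}. (\<theta> j)\<^sup>2))\<^sup>2" using assms(2) by (rule power_mono)
  then show ?thesis by (simp add: sum_nonneg)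
qed

lemma lq_ball_sum_powr_le:
  assumes \<theta>: "\<theta> \<in> lq_ball d q r" and q: "q > 0" and r: "r > 0"
  shows "(\<Sum>j\<in>{1..d}. \<bar>\<theta> j\<bar> powr q) \<le> r powr q"
proof -
  have "(\<Sum>j\<in>{1..d}. \<bar>\<theta> j\<bar> powr q) powr (1 / q) \<le> r"
    using \<theta> q by (simp add: lq_ball_def lq_norm_def)
  then have "((\<Sum>j\<in>{1..d}. \<bar>\<theta> j\<bar> powr q) powr (1 / q)) powr q \<le> r powr q"
    using q by (intro powr_mono2) auto
  then show ?thesis using q by (simp add: powr_powr sum_nonneg)
qed

lemma power2_eq_powr_mult: "x \<noteq> 0 \<Longrightarrow> (x::real)\<^sup>2 = \<bar>x\<bar> powr q * \<bar>x\<bar> powr (2 - q)"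
  by (simp flip: powr_add)

text \<open>Interpolation: a square is the power \<open>q\<close> times the power
  \<open>2 - q\<close>, and the second factor is bounded through \<open>c\<close>. The constant is 1
  for every \<open>q\<close>, which keeps the final constants free of \<open>q\<close>.\<close>

lemma sum_square_le_powr:
  fixes \<theta> :: "'a \<Rightarrow> real" and q c :: real
  assumes "q < 2" "\<And>j. j \<in> J \<Longrightarrow> \<bar>\<theta> j\<bar> \<le> c"
  shows "(\<Sum>j\<in>J. (\<theta> j)\<^sup>2) \<le> (\<Sum>j\<in>J. \<bar>\<theta> j\<bar> powr q) * c powr (2 - q)"
  unfolding sum_distrib_right
proof (rule sum_mono)
  fix j assume "j \<in> J"
  then show "(\<theta> j)\<^sup>2 \<le> \<bar>\<theta> j\<bar> powr q * c powr (2 - q)"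
    using assms by (cases "\<theta> j = 0") (auto simp: power2_eq_powr_mult[of _ q] intro!: mult_left_mono powr_mono2)
qed

text \<open>Each coordinate is bounded by \<open>r\<close>, so interpolation at \<open>c = r\<close>
  applies. It makes alternatives with separation above \<open>r\<close> empty.\<close>

lemma lq_norm_2_le:
  assumes \<theta>: "\<theta> \<in> lq_ball d q r" and q: "0 < q" "q < 2" and r: "r > 0"
  shows "lq_norm d 2 \<theta> \<le> r"
proof -
  note S = lq_ball_sum_powr_le[OF \<theta> q(1) r]
  have "\<bar>\<theta> j\<bar> \<le> r" if "j \<in> {1..d}" for j
  proof -
    have "\<bar>\<theta> j\<bar> powr q \<le> r powr q"
      using member_le_sum[OF that, of "\<lambda>j. \<bar>\<theta> j\<bar> powr q"] S by simp
    then show ?thesis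
      using powr_less_mono2[of q r "\<bar>\<theta> j\<bar>"] q r by linarith
  qed
  then have "(\<Sum>j\<in>{1..d}. (\<theta> j)\<^sup>2) \<le> (\<Sum>j\<in>{1..d}. \<bar>\<theta> j\<bar> powr q) * r powr (2 - q)"
    by (rule sum_square_le_powr[OF q(2)])
  also have "\<dots> \<le> r powr q * r powr (2 - q)"
    by (intro mult_right_mono S) simp
  also have "\<dots> = r\<^sup>2" using r power2_eq_powr_mult[of r q] by simp
  finally show ?thesis using r by (simp add: lq_norm_2 real_le_lsqrt)
qed

text \<open>The test that always accepts makes no error: it never rejects the null hypothesis, and
  the supremum over no alternatives is 0.\<close>

lemma testing_risk_empty:
  assumes "alternative_set d q u \<delta> = {}"
  shows "testing_risk d \<sigma> q u \<delta> = 0"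
proof -
  have "(\<lambda>_. 0) \<in> tests d" by (simp add: tests_def)
  from INF_lower[OF this, of "\<lambda>\<Delta>. emeasure (obs_law d \<sigma> (zero_vec d)) {y \<in> space (obs_space d). \<Delta> y = 1}
        + (SUP \<theta>\<in>alternative_set d q u \<delta>. emeasure (obs_law d \<sigma> \<theta>) {y \<in> space (obs_space d). \<Delta> y = 0})"]
  show ?thesis using assms by (simp add: testing_risk_def bot_ennreal)
qed

lemma testing_risk_le_dense_rate:
  assumes \<sigma>: "\<sigma> > 0" and \<epsilon>: "0 < \<epsilon>" "\<epsilon> < 1" and d: "d \<ge> 1" and A: "112 / \<epsilon> \<le> A"
  shows "testing_risk d \<sigma> q u (A * sqrt (\<sigma>\<^sup>2 * sqrt (real d))) \<le> ennreal \<epsilon>"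
proof (rule testing_risk_le_dense[OF \<sigma> \<epsilon> d])
  have "1 \<le> 112 / \<epsilon>" using \<epsilon> by (simp add: le_divide_eq)
  with A have A1: "1 \<le> A" by linarith
  fix \<theta> assume \<theta>: "\<theta> \<in> alternative_set d q u (A * sqrt (\<sigma>\<^sup>2 * sqrt (real d)))"
  have "112 / \<epsilon> * (\<sigma>\<^sup>2 * sqrt (real d)) \<le> A\<^sup>2 * (\<sigma>\<^sup>2 * sqrt (real d))"
    using A self_le_power[OF A1, of 2] by (intro mult_right_mono) auto
  also have "\<dots> = (A * sqrt (\<sigma>\<^sup>2 * sqrt (real d)))\<^sup>2"
    by (simp add: power_mult_distrib)
  also have "\<dots> \<le> (\<Sum>j\<in>{1..d}. (\<theta> j)\<^sup>2)"
    using A1 by (intro alternative_set_sum_square[OF \<theta>]) simp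
  finally show "112 / \<epsilon> * \<sigma>\<^sup>2 * sqrt (real d) \<le> (\<Sum>j\<in>{1..d}. (\<theta> j)\<^sup>2)" by (simp add: mult.assoc)
qed

text \<open>Coordinates outside \<open>B\<close> may carry up to twice
  \<open>\<sigma>\<^sup>2 * (s * L)\<close> of the squared norm. The summand 2 in the bound on
  \<open>A\<close> pays for them and leaves the amount with factor \<open>4000 / \<epsilon>\<close>
  inside \<open>B\<close>.\<close>

lemma testing_risk_le_sparse_rate:
  assumes \<sigma>: "\<sigma> > 0" and \<epsilon>: "0 < \<epsilon>" "\<epsilon> < 1" and s: "1 \<le> s" "real s \<le> sqrt (real d)"
    and A: "4000 / \<epsilon> + 2 \<le> A"
  defines "L \<equiv> sparsity_log d s"
  defines "B \<equiv> \<lambda>\<theta>. {j\<in>{1..d}. \<sigma> * sqrt L < \<bar>\<theta> j\<bar>}"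
  assumes large: "\<And>\<theta>. \<theta> \<in> lq_ball d q u \<Longrightarrow> card (B \<theta>) \<le> s"
    and small: "\<And>\<theta>. \<theta> \<in> lq_ball d q u \<Longrightarrow> (\<Sum>j\<in>{1..d} - B \<theta>. (\<theta> j)\<^sup>2) \<le> 2 * (\<sigma>\<^sup>2 * (real s * L))"
  shows "testing_risk d \<sigma> q u (A * sqrt (\<sigma>\<^sup>2 * (real s * L))) \<le> ennreal \<epsilon>"
proof (rule testing_risk_le_sparse[OF \<sigma> \<epsilon> s])
  have A1: "1 \<le> A" using A \<epsilon> divide_pos_pos[of 4000 \<epsilon>] by linarith
  have L: "L \<ge> 0" by (simp add: L_def sparsity_log_nonneg)
  define R where "R = \<sigma>\<^sup>2 * (real s * L)"
  have R: "R \<ge> 0" using L by (simp add: R_def)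
  fix \<theta> assume \<theta>: "\<theta> \<in> alternative_set d q u (A * sqrt (\<sigma>\<^sup>2 * (real s * L)))"
  then have ball: "\<theta> \<in> lq_ball d q u" by (simp add: alternative_set_def)
  have "(4000 / \<epsilon> + 2) * R \<le> A\<^sup>2 * R"
    using A self_le_power[OF A1, of 2] R by (intro mult_right_mono) auto
  also have "\<dots> = (A * sqrt R)\<^sup>2"
    using R by (simp add: power_mult_distrib)
  also have "\<dots> \<le> (\<Sum>j\<in>{1..d}. (\<theta> j)\<^sup>2)"
    using A1 R \<theta> by (intro alternative_set_sum_square[of _ _ q u]) (auto simp: R_def)
  also have "\<dots> = (\<Sum>j\<in>{1..d} - B \<theta>. (\<theta> j)\<^sup>2) + (\<Sum>j\<in>B \<theta>. (\<theta> j)\<^sup>2)"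
    by (rule sum.subset_diff) (auto simp: B_def)
  finally have "4000 / \<epsilon> * R \<le> (\<Sum>j\<in>B \<theta>. (\<theta> j)\<^sup>2)"
    using small[OF ball] by (simp add: R_def distrib_right)
  then have "card (B \<theta>) \<le> s \<and> 4000 / \<epsilon> * \<sigma>\<^sup>2 * (real s * L) \<le> (\<Sum>j\<in>B \<theta>. (\<theta> j)\<^sup>2)"
    using large[OF ball] by (simp add: R_def mult.assoc)
  then show "card {j\<in>{1..d}. \<sigma> * sqrt (sparsity_log d s) < \<bar>\<theta> j\<bar>} \<le> s
      \<and> 4000 / \<epsilon> * \<sigma>\<^sup>2 * (real s * sparsity_log d s)
        \<le> (\<Sum>j\<in>{j\<in>{1..d}. \<sigma> * sqrt (sparsity_log d s) < \<bar>\<theta> j\<bar>}. (\<theta> j)\<^sup>2)"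
    unfolding L_def B_def .
qed

lemma sparse_ball_split:
  assumes \<theta>: "\<theta> \<in> lq_ball d 0 (real s)" and c: "c \<ge> 0"
  shows "card {j\<in>{1..d}. c < \<bar>\<theta> j\<bar>} \<le> s"
    and "(\<Sum>j\<in>{1..d} - {j\<in>{1..d}. c < \<bar>\<theta> j\<bar>}. (\<theta> j)\<^sup>2) \<le> real s * c\<^sup>2"
proof -
  let ?Z = "{j\<in>{1..d}. \<theta> j \<noteq> 0}"
  have Z: "card ?Z \<le> s" using \<theta> by (simp add: lq_ball_def lq_norm_def)
  have "card {j\<in>{1..d}. c < \<bar>\<theta> j\<bar>} \<le> card ?Z" using c by (intro card_mono) auto
  with Z show "card {j\<in>{1..d}. c < \<bar>\<theta> j\<bar>} \<le> s" by simp
  have "(\<Sum>j\<in>{1..d} - {j\<in>{1..d}. c < \<bar>\<theta> j\<bar>}. (\<theta> j)\<^sup>2) = (\<Sum>j\<in>?Z - {j\<in>{1..d}. c < \<bar>\<theta> j\<bar>}. (\<theta> j)\<^sup>2)"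
    by (intro sum.mono_neutral_right) auto
  also have "\<dots> \<le> (\<Sum>j\<in>?Z - {j\<in>{1..d}. c < \<bar>\<theta> j\<bar>}. c\<^sup>2)"
    using c by (intro sum_mono) (auto simp: abs_le_square_iff[symmetric])
  also have "\<dots> \<le> (\<Sum>j\<in>?Z. c\<^sup>2)" by (intro sum_mono2) auto
  also have "\<dots> \<le> real s * c\<^sup>2" using Z by (simp add: mult_right_mono)
  finally show "(\<Sum>j\<in>{1..d} - {j\<in>{1..d}. c < \<bar>\<theta> j\<bar>}. (\<theta> j)\<^sup>2) \<le> real s * c\<^sup>2" .
qed

lemma lq_ball_split:
  assumes \<theta>: "\<theta> \<in> lq_ball d q r" and q: "0 < q" "q < 2" and r: "r > 0" and c: "c > 0"
    and rc: "r powr q < real (s + 1) * c powr q" and s: "s \<ge> 1"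
  shows "card {j\<in>{1..d}. c < \<bar>\<theta> j\<bar>} \<le> s"
    and "(\<Sum>j\<in>{1..d} - {j\<in>{1..d}. c < \<bar>\<theta> j\<bar>}. (\<theta> j)\<^sup>2) \<le> 2 * (real s * c\<^sup>2)"
proof -
  let ?B = "{j\<in>{1..d}. c < \<bar>\<theta> j\<bar>}"
  note S = lq_ball_sum_powr_le[OF \<theta> q(1) r]
  have "real (card ?B) * c powr q \<le> (\<Sum>j\<in>?B. \<bar>\<theta> j\<bar> powr q)"
    using c q by (intro sum_bounded_below) (auto intro!: powr_mono2)
  also have "\<dots> \<le> (\<Sum>j\<in>{1..d}. \<bar>\<theta> j\<bar> powr q)" by (intro sum_mono2) auto
  finally have "real (card ?B) * c powr q < real (s + 1) * c powr q" using S rc by linarith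
  \<comment> \<open>Strictness against \<open>s + 1\<close> is what gives at most \<open>s\<close>
    large coordinates.\<close>
  then have "real (card ?B) < real (s + 1)" using c by (simp only: mult_less_cancel_right_pos powr_gt_zero)
  then show "card ?B \<le> s" by simp
  have "(\<Sum>j\<in>{1..d} - ?B. (\<theta> j)\<^sup>2) \<le> (\<Sum>j\<in>{1..d} - ?B. \<bar>\<theta> j\<bar> powr q) * c powr (2 - q)"
    by (rule sum_square_le_powr[OF q(2)]) auto
  also have "\<dots> \<le> (\<Sum>j\<in>{1..d}. \<bar>\<theta> j\<bar> powr q) * c powr (2 - q)"
    by (intro mult_right_mono sum_mono2) auto
  also have "\<dots> \<le> (real (s + 1) * c powr q) * c powr (2 - q)"
    using S rc by (intro mult_right_mono) auto
  also have "\<dots> = real (s + 1) * c\<^sup>2" using c power2_eq_powr_mult[of c q] by simp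
  also have "\<dots> \<le> (2 * real s) * c\<^sup>2" using s by (intro mult_right_mono) auto
  finally show "(\<Sum>j\<in>{1..d} - ?B. (\<theta> j)\<^sup>2) \<le> 2 * (real s * c\<^sup>2)" by simp
qed

text \<open>Failure at \<open>s + 1\<close> is raised to the power \<open>q / 2\<close>. The
  logarithm decreases in \<open>s\<close>, so the threshold may be taken at \<open>s\<close>, the
  level used by the test.\<close>

lemma not_sparsity_level_imp:
  assumes q: "0 < q" and r: "r > 0" and \<sigma>: "\<sigma> > 0" and s: "s \<ge> 1"
    and out: "s + 1 \<notin> sparsity_levels \<sigma> q r d"
  shows "r powr q < real (s + 1) * (\<sigma> * sqrt (sparsity_log d s)) powr q"
proof -
  define n where "n = real (s + 1)"
  have n: "n > 0" by (simp add: n_def)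
  define c where "c = \<sigma> * sqrt (sparsity_log d s)"
  have c: "c \<ge> 0" using \<sigma> by (simp add: c_def sparsity_log_nonneg)
  have "sparsity_log d (s + 1) \<le> sparsity_log d s"
    unfolding sparsity_log_def using s
    by (intro ln_mono add_left_mono divide_left_mono power_mono) (auto intro: add_pos_nonneg)
  have "(r * n powr (- (1 / q)))\<^sup>2 = r\<^sup>2 * n powr (- (2 / q))"
    using n by (simp add: power_mult_distrib power2_eq_square flip: powr_add)
  also have "\<dots> < \<sigma>\<^sup>2 * sparsity_log d (s + 1)"
    using out by (simp add: sparsity_levels_iff n_def)
  also have "\<dots> \<le> \<sigma>\<^sup>2 * sparsity_log d s"
    by (intro mult_left_mono) (fact, simp)
  also have "\<dots> = c\<^sup>2" by (simp add: c_def power_mult_distrib sparsity_log_nonneg)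
  finally have "r * n powr (- (1 / q)) < c" using c by (rule power2_less_imp_less)
  then have "(r * n powr (- (1 / q))) powr q < c powr q"
    using q r by (intro powr_less_mono2) auto
  then have "r powr q * n powr (- 1) < c powr q"
    using q r n by (simp add: powr_mult powr_powr)
  moreover have "n powr (- 1) = 1 / n" using n by (simp add: powr_minus_divide)
  ultimately have "r powr q < n * c powr q" using n by (simp add: divide_less_eq mult.commute)
  then show ?thesis by (simp only: n_def c_def)
qed

text \<open>The opposite use of the defining inequality: at a level \<open>s\<close>, the ball has
  room for \<open>s\<close> entries of height
  \<open>\<sigma> * sqrt (sparsity_log d s)\<close>.\<close>

lemma sparsity_level_flat_norm:
  assumes q: "0 < q" and r: "r > 0" and s: "s \<in> sparsity_levels \<sigma> q r d"
    and a: "0 \<le> a" "a\<^sup>2 \<le> \<sigma>\<^sup>2 * sparsity_log d s"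
  shows "(real s * a powr q) powr (1 / q) \<le> r"
proof -
  have s1: "s \<ge> 1" using s by (simp add: sparsity_levels_iff)
  have "a\<^sup>2 \<le> r\<^sup>2 * real s powr (- (2 / q))" using a s by (simp add: sparsity_levels_iff)
  also have "\<dots> = (r * real s powr (- (1 / q)))\<^sup>2"
    using s1 by (simp add: power_mult_distrib power2_eq_square flip: powr_add)
  finally have "a \<le> r * real s powr (- (1 / q))" using r by (intro power2_le_imp_le[of a]) auto
  then have "a powr q \<le> (r * real s powr (- (1 / q))) powr q"
    using a q by (intro powr_mono2) auto
  also have "\<dots> = r powr q * real s powr (- 1)"
    using q r s1 by (simp add: powr_mult powr_powr)
  also have "real s powr (- 1) = 1 / real s" using s1 by (simp add: powr_minus_divide)
  finally have "real s * a powr q \<le> r powr q" using s1 by (simp add: le_divide_eq mult.commute)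
  then have "(real s * a powr q) powr (1 / q) \<le> (r powr q) powr (1 / q)"
    using q by (intro powr_mono2) auto
  then show ?thesis using q r by (simp add: powr_powr)
qed

text \<open>One condition for both kinds of ball: \<open>s\<close> entries of height up to
  \<open>\<sigma> * sqrt (sparsity_log d s)\<close> fit into the ball of radius \<open>u\<close>. It
  lets the lower bounds be proved once.\<close>

definition admissible_level :: "real \<Rightarrow> real \<Rightarrow> real \<Rightarrow> nat \<Rightarrow> nat \<Rightarrow> bool" where
  "admissible_level \<sigma> q u d s \<longleftrightarrow> (if q = 0 then real s \<le> u else 0 < q \<and> 0 < u \<and> s \<in> sparsity_levels \<sigma> q u d)"

lemma testing_risk_ge_level:
  assumes \<sigma>: "\<sigma> > 0" and s: "1 \<le> s" "s \<le> d" and A: "0 \<le> A" "A \<le> 1"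
    and level: "admissible_level \<sigma> q u d s"
    and \<delta>: "\<delta> \<le> A * sqrt (\<sigma>\<^sup>2 * (real s * sparsity_log d s))"
  shows "ennreal (1 - sqrt (exp (2 * A\<^sup>2) - 1)) \<le> testing_risk d \<sigma> q u \<delta>"
proof (rule testing_risk_lower[OF \<sigma> s A])
  let ?a = "A * \<sigma> * sqrt (sparsity_log d s)"
  show "0 \<le> ?a" using A \<sigma> by (simp add: sparsity_log_nonneg)
  have a2: "?a\<^sup>2 = A\<^sup>2 * \<sigma>\<^sup>2 * sparsity_log d s" by (simp add: power_mult_distrib sparsity_log_nonneg)
  then show "?a\<^sup>2 \<le> A\<^sup>2 * \<sigma>\<^sup>2 * sparsity_log d s" by simp
  have "A\<^sup>2 * (\<sigma>\<^sup>2 * sparsity_log d s) \<le> 1 * (\<sigma>\<^sup>2 * sparsity_log d s)"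
    using A by (intro mult_right_mono) (auto simp: sparsity_log_nonneg power_le_one)
  then have "?a\<^sup>2 \<le> \<sigma>\<^sup>2 * sparsity_log d s" using a2 by simp
  with level show "if q = 0 then real s \<le> u else (real s * ?a powr q) powr (1 / q) \<le> u"
    using \<open>0 \<le> ?a\<close> by (auto simp: admissible_level_def intro!: sparsity_level_flat_norm)
  show "q \<ge> 0" using level by (auto simp: admissible_level_def split: if_splits)
  show "\<delta> \<le> sqrt (real s) * ?a"
    using \<delta> \<sigma> by (simp add: real_sqrt_mult mult_ac)
qed

text \<open>Apply the bound at the integer part of \<open>sqrt d\<close>. There \<open>s\<close> is
  at least \<open>sqrt d / 2\<close> and the logarithm at least 1/2, so their product is at least a
  quarter of \<open>sqrt d\<close>; the root of 4 is the factor 2 in \<open>2 * A\<close>.\<close>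

lemma testing_risk_ge_dense:
  assumes \<sigma>: "\<sigma> > 0" and d: "d \<ge> 1" and A: "0 \<le> A" "2 * A \<le> 1"
    and level: "\<And>s. 1 \<le> s \<Longrightarrow> real s \<le> sqrt (real d) \<Longrightarrow> admissible_level \<sigma> q u d s"
  shows "ennreal (1 - sqrt (exp (2 * (2 * A)\<^sup>2) - 1)) \<le> testing_risk d \<sigma> q u (A * sqrt (\<sigma>\<^sup>2 * sqrt (real d)))"
proof -
  define s where "s = nat \<lfloor>sqrt (real d)\<rfloor>"
  have d1: "1 \<le> sqrt (real d)" using d by simp
  have s1: "1 \<le> s" using d1 by (simp add: s_def le_nat_floor)
  have s_le: "real s \<le> sqrt (real d)" by (simp add: s_def)
  have "sqrt (real d) < real s + 1" unfolding s_def using d1 by linarith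
  then have s_ge: "sqrt (real d) \<le> 2 * real s" using s1 by linarith
  have "sqrt (real d) * 1 \<le> sqrt (real d) * sqrt (real d)" using d1 by (intro mult_left_mono) auto
  then have "real s \<le> real d" using s_le by simp
  then have sd: "s \<le> d" by simp
  have "sqrt (real d) \<le> 4 * (real s * sparsity_log d s)"
    using s_ge mult_left_mono[OF sparsity_log_ge_half[OF s1 s_le], of "real s"] by simp
  then have "sqrt (\<sigma>\<^sup>2 * sqrt (real d)) \<le> sqrt (\<sigma>\<^sup>2 * (4 * (real s * sparsity_log d s)))"
    by (intro real_sqrt_le_mono mult_left_mono) auto
  also have "\<dots> = 2 * sqrt (\<sigma>\<^sup>2 * (real s * sparsity_log d s))"
    by (simp add: real_sqrt_mult)
  finally have "A * sqrt (\<sigma>\<^sup>2 * sqrt (real d)) \<le> 2 * A * sqrt (\<sigma>\<^sup>2 * (real s * sparsity_log d s))"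
    using A by (simp add: mult_left_mono mult.left_commute[of 2] mult.assoc)
  then show ?thesis
    using A by (intro testing_risk_ge_level[OF \<sigma> s1 sd _ _ level[OF s1 s_le]]) auto
qed

lemma small_radius_exists:
  fixes \<epsilon> :: real
  assumes "0 < \<epsilon>" "\<epsilon> < 1"
  obtains a\<^sub>0 where "a\<^sub>0 > 0" and "\<And>A. 0 < A \<Longrightarrow> A < a\<^sub>0 \<Longrightarrow> 2 * A \<le> 1 \<and> 1 - \<epsilon> \<le> 1 - sqrt (exp (2 * (2 * A)\<^sup>2) - 1)"
proof
  \<comment> \<open>For \<open>sqrt (exp (8 * A\<^sup>2) - 1) \<le> \<epsilon>\<close> it suffices
    that \<open>8 * A\<^sup>2\<close> stays below \<open>l\<close>, whence the radius
    \<open>sqrt (l / 8)\<close>.\<close>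
  define l where "l = ln (1 + \<epsilon>\<^sup>2)"
  have l: "l > 0" unfolding l_def using assms by (intro ln_gt_zero) simp
  have "l \<le> \<epsilon>\<^sup>2" unfolding l_def by (rule ln_add_one_self_le_self) simp
  also have "\<dots> \<le> 1" using assms by (simp add: power_le_one)
  finally have l1: "l \<le> 1" .
  show "sqrt (l / 8) > 0" using l by simp
  fix A assume A: "0 < A" "A < sqrt (l / 8)"
  then have "A\<^sup>2 < (sqrt (l / 8))\<^sup>2" by (intro power_strict_mono) auto
  then have A2: "2 * (2 * A)\<^sup>2 < l" using l by (simp add: power_mult_distrib)
  then have "(2 * A)\<^sup>2 \<le> 1\<^sup>2" using l1 by simp
  then have "2 * A \<le> 1" by (rule power2_le_imp_le) simp
  moreover have "exp (2 * (2 * A)\<^sup>2) \<le> exp l" using A2 by simp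
  then have "sqrt (exp (2 * (2 * A)\<^sup>2) - 1) \<le> sqrt (\<epsilon>\<^sup>2)"
    by (intro real_sqrt_le_mono) (simp add: l_def add_pos_nonneg)
  then have "1 - \<epsilon> \<le> 1 - sqrt (exp (2 * (2 * A)\<^sup>2) - 1)" using assms by simp
  ultimately show "2 * A \<le> 1 \<and> 1 - \<epsilon> \<le> 1 - sqrt (exp (2 * (2 * A)\<^sup>2) - 1)" ..
qed

lemma sparsity_log_pos: "1 \<le> s \<Longrightarrow> 1 \<le> d \<Longrightarrow> sparsity_log d s > 0"
  unfolding sparsity_log_def by (intro ln_gt_zero) simp

lemma psi_sparse_eq:
  "psi_sparse \<sigma> s d = (if real s < sqrt (real d) then \<sigma>\<^sup>2 * (real s * sparsity_log d s) else \<sigma>\<^sup>2 * sqrt (real d))"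
  by (simp add: psi_sparse_def sparsity_log_def mult.assoc)

section \<open>Risk bounds at the claimed rates\<close>

lemma sparse_risk_le:
  assumes s: "1 \<le> s" "s \<le> d" and \<sigma>: "\<sigma> > 0" and \<epsilon>: "0 < \<epsilon>" "\<epsilon> < 1" and A: "4000 / \<epsilon> + 2 < A"
  shows "testing_risk d \<sigma> 0 (real s) (A * sqrt (psi_sparse \<sigma> s d)) \<le> ennreal \<epsilon>"
proof (cases "real s < sqrt (real d)")
  case True
  have "testing_risk d \<sigma> 0 (real s) (A * sqrt (\<sigma>\<^sup>2 * (real s * sparsity_log d s))) \<le> ennreal \<epsilon>"
  proof (rule testing_risk_le_sparse_rate[OF \<sigma> \<epsilon> s(1)])
    fix \<theta> assume \<theta>: "\<theta> \<in> lq_ball d 0 (real s)"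
    have c: "0 \<le> \<sigma> * sqrt (sparsity_log d s)" using \<sigma> by (simp add: sparsity_log_nonneg)
    have c2: "(\<sigma> * sqrt (sparsity_log d s))\<^sup>2 = \<sigma>\<^sup>2 * sparsity_log d s"
      by (simp add: power_mult_distrib sparsity_log_nonneg)
    show "card {j\<in>{1..d}. \<sigma> * sqrt (sparsity_log d s) < \<bar>\<theta> j\<bar>} \<le> s"
      by (rule sparse_ball_split(1)[OF \<theta> c])
    have "0 \<le> real s * (\<sigma>\<^sup>2 * sparsity_log d s)" by (simp add: sparsity_log_nonneg)
    then show "(\<Sum>j\<in>{1..d} - {j\<in>{1..d}. \<sigma> * sqrt (sparsity_log d s) < \<bar>\<theta> j\<bar>}. (\<theta> j)\<^sup>2)
        \<le> 2 * (\<sigma>\<^sup>2 * (real s * sparsity_log d s))"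
      using sparse_ball_split(2)[OF \<theta> c] unfolding c2 by (simp add: mult.left_commute)
  qed (use True A in auto)
  with True show ?thesis by (simp add: psi_sparse_eq)
next
  case False
  have "112 / \<epsilon> \<le> 4000 / \<epsilon> + 2" using \<epsilon> by (intro add_increasing2 divide_right_mono) auto
  with False A s \<epsilon> show ?thesis
    by (simp add: psi_sparse_eq testing_risk_le_dense_rate[OF \<sigma> \<epsilon>])
qed

lemma sparse_risk_ge:
  assumes s: "1 \<le> s" "s \<le> d" and \<sigma>: "\<sigma> > 0" and A: "0 < A" "2 * A \<le> 1"
  shows "ennreal (1 - sqrt (exp (2 * (2 * A)\<^sup>2) - 1)) \<le> testing_risk d \<sigma> 0 (real s) (A * sqrt (psi_sparse \<sigma> s d))"
proof (cases "real s < sqrt (real d)")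
  case True
  \<comment> \<open>The dense case bounds the risk in terms of \<open>2 * A\<close>, so the sparse
    case is weakened to the same form.\<close>
  have "A * sqrt (\<sigma>\<^sup>2 * (real s * sparsity_log d s)) \<le> 2 * A * sqrt (\<sigma>\<^sup>2 * (real s * sparsity_log d s))"
    using A by (intro mult_right_mono) (auto simp: sparsity_log_nonneg)
  then show ?thesis
    using True A by (intro testing_risk_ge_level[OF \<sigma> s]) (auto simp: psi_sparse_eq admissible_level_def)
next
  case False
  then show ?thesis
    using testing_risk_ge_dense[OF \<sigma>, of d A 0 "real s"] s A by (simp add: psi_sparse_eq admissible_level_def)
qed

lemma ball_risk_le:
  assumes q: "0 < q" "q < 2" and r: "r > 0" and d: "1 \<le> d" and \<sigma>: "\<sigma> > 0"
    and \<epsilon>: "0 < \<epsilon>" "\<epsilon> < 1" and A: "4000 / \<epsilon> + 2 < A"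
  shows "testing_risk d \<sigma> q r (A * sqrt (psi_ball \<sigma> q r d)) \<le> ennreal \<epsilon>"
  using q r
proof (cases rule: psi_ball_cases[where \<sigma> = \<sigma> and d = d])
  case dense
  have "112 / \<epsilon> \<le> 4000 / \<epsilon> + 2" using \<epsilon> by (intro add_increasing2 divide_right_mono) auto
  with dense A d \<epsilon> show ?thesis
    by (simp add: testing_risk_le_dense_rate[OF \<sigma> \<epsilon>])
next
  case (sparse m)
  have L: "sparsity_log d m > 0" using sparse d by (intro sparsity_log_pos) auto
  have c: "0 < \<sigma> * sqrt (sparsity_log d m)" using \<sigma> L by simp
  have c2: "(\<sigma> * sqrt (sparsity_log d m))\<^sup>2 = \<sigma>\<^sup>2 * sparsity_log d m"
    by (simp add: power_mult_distrib sparsity_log_nonneg)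
  note rc = not_sparsity_level_imp[OF q(1) r \<sigma> sparse(2,5)]
  show ?thesis
    unfolding sparse(1)
  proof (rule testing_risk_le_sparse_rate[OF \<sigma> \<epsilon> sparse(2,3)])
    fix \<theta> assume \<theta>: "\<theta> \<in> lq_ball d q r"
    note split = lq_ball_split[OF \<theta> q r c rc sparse(2)]
    show "card {j\<in>{1..d}. \<sigma> * sqrt (sparsity_log d m) < \<bar>\<theta> j\<bar>} \<le> m"
      by (rule split(1))
    show "(\<Sum>j\<in>{1..d} - {j\<in>{1..d}. \<sigma> * sqrt (sparsity_log d m) < \<bar>\<theta> j\<bar>}. (\<theta> j)\<^sup>2)
        \<le> 2 * (\<sigma>\<^sup>2 * (real m * sparsity_log d m))"
      using split(2) unfolding c2 by (simp add: mult.left_commute)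
  qed (use A in simp)
next
  case zero
  \<comment> \<open>Here the rate is \<open>r\<close>, which bounds the 2-norm on the ball, so for
    \<open>A > 1\<close> the alternative is empty.\<close>
  have "1 < A" using A \<epsilon> divide_pos_pos[of 4000 \<epsilon>] by linarith
  then have "r < A * sqrt (psi_ball \<sigma> q r d)" using zero r by simp
  then have "alternative_set d q r (A * sqrt (psi_ball \<sigma> q r d)) = {}"
    using lq_norm_2_le[OF _ q r, of _ d] by (fastforce simp: alternative_set_def)
  then show ?thesis by (simp add: testing_risk_empty)
qed

lemma ball_risk_ge:
  assumes q: "0 < q" "q < 2" and r: "r > 0" and d: "1 \<le> d" and \<sigma>: "\<sigma> > 0" and A: "0 < A" "2 * A \<le> 1"
  shows "ennreal (1 - sqrt (exp (2 * (2 * A)\<^sup>2) - 1)) \<le> testing_risk d \<sigma> q r (A * sqrt (psi_ball \<sigma> q r d))"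
  using q r
proof (cases rule: psi_ball_cases[where \<sigma> = \<sigma> and d = d])
  case dense
  then show ?thesis
    unfolding dense(1) using q r A
    by (intro testing_risk_ge_dense[OF \<sigma> d]) (auto simp: admissible_level_def)
next
  case (sparse m)
  have "A * sqrt (\<sigma>\<^sup>2 * (real m * sparsity_log d m)) \<le> 2 * A * sqrt (\<sigma>\<^sup>2 * (real m * sparsity_log d m))"
    using A by (intro mult_right_mono) (auto simp: sparsity_log_nonneg)
  moreover have "m \<le> d"
  proof -
    have "sqrt (real d) * 1 \<le> sqrt (real d) * sqrt (real d)" using d by (intro mult_left_mono) auto
    then have "real m \<le> real d" using sparse(3) by simp
    then show ?thesis by simp
  qed
  ultimately show ?thesis
    unfolding sparse(1) using sparse q r A
    by (intro testing_risk_ge_level[OF \<sigma> sparse(2)]) (auto simp: admissible_level_def)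
next
  case zero
  then have r2: "r\<^sup>2 \<le> \<sigma>\<^sup>2 * sparsity_log d 1" by (simp add: sparsity_levels_iff)
  show ?thesis
  \<comment> \<open>Level 1 fails, so \<open>r\<close> lies below the detection height of a single
    spike. One spike of height \<open>A * r\<close> has exactly the required 2-norm and stays in the
    ball.\<close>
  proof (rule testing_risk_lower[OF \<sigma>, where s = 1 and a = "A * r"])
    have "(A * r)\<^sup>2 \<le> (2 * A)\<^sup>2 * r\<^sup>2" using A by (simp add: power_mult_distrib)
    also have "\<dots> \<le> (2 * A)\<^sup>2 * (\<sigma>\<^sup>2 * sparsity_log d 1)" by (intro mult_left_mono r2) simp
    finally show "(A * r)\<^sup>2 \<le> (2 * A)\<^sup>2 * \<sigma>\<^sup>2 * sparsity_log d 1" by (simp add: mult.assoc)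
    have "A * r \<le> r" using A r by simp
    then show "if q = 0 then real 1 \<le> r else (real 1 * (A * r) powr q) powr (1 / q) \<le> r"
      using q r A by (simp add: powr_powr)
    show "A * sqrt (psi_ball \<sigma> q r d) \<le> sqrt (real 1) * (A * r)" using zero r by simp
  qed (use A q r d in auto)
qed

lemma psi_sparse_pos: "1 \<le> s \<Longrightarrow> s \<le> d \<Longrightarrow> \<sigma> > 0 \<Longrightarrow> psi_sparse \<sigma> s d > 0"
  by (simp add: psi_sparse_eq sparsity_log_pos)

lemma psi_ball_pos:
  assumes "0 < q" "q < 2" "r > 0" "1 \<le> d" "\<sigma> > 0"
  shows "psi_ball \<sigma> q r d > 0"
  using assms(1-3) by (cases rule: psi_ball_cases[where \<sigma> = \<sigma> and d = d])
    (use assms in \<open>auto simp: sparsity_log_pos\<close>)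

theorem theorem12:
  shows "minimax_testing_rate
      {(s::nat, d::nat, \<sigma>::real). 1 \<le> s \<and> s \<le> d \<and> \<sigma> > 0}
      (\<lambda>(s, d, \<sigma>). testing_risk d \<sigma> 0 (real s))
      (\<lambda>(s, d, \<sigma>). sqrt (psi_sparse \<sigma> s d))
    \<and> minimax_testing_rate
      {(q::real, r::real, d::nat, \<sigma>::real). 0 < q \<and> q < 2 \<and> r > 0 \<and> 1 \<le> d \<and> \<sigma> > 0}
      (\<lambda>(q, r, d, \<sigma>). testing_risk d \<sigma> q r)
      (\<lambda>(q, r, d, \<sigma>). sqrt (psi_ball \<sigma> q r d))"
proof -
  \<comment> \<open>This constant and \<open>a\<^sub>0\<close> below depend on
    \<open>\<epsilon>\<close> alone, which is the uniformity that a rate demands.\<close>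
  have large: "4000 / \<epsilon> + 2 > 0" if "0 < \<epsilon>" for \<epsilon> :: real
    using that by (intro add_pos_pos divide_pos_pos) auto
  have "minimax_testing_rate
      {(s::nat, d::nat, \<sigma>::real). 1 \<le> s \<and> s \<le> d \<and> \<sigma> > 0}
      (\<lambda>(s, d, \<sigma>). testing_risk d \<sigma> 0 (real s))
      (\<lambda>(s, d, \<sigma>). sqrt (psi_sparse \<sigma> s d))"
    unfolding minimax_testing_rate_def
  proof (intro conjI allI impI)
    fix \<epsilon> :: real assume "0 < \<epsilon> \<and> \<epsilon> < 1"
    then have \<epsilon>: "0 < \<epsilon>" "\<epsilon> < 1" by auto
    show "\<exists>A\<^sub>0>0. \<forall>i\<in>{(s::nat, d::nat, \<sigma>::real). 1 \<le> s \<and> s \<le> d \<and> \<sigma> > 0}. \<forall>A>A\<^sub>0.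
        (case i of (s, d, \<sigma>) \<Rightarrow> testing_risk d \<sigma> 0 (real s)) (A * (case i of (s, d, \<sigma>) \<Rightarrow> sqrt (psi_sparse \<sigma> s d)))
          \<le> ennreal \<epsilon>"
      using large[OF \<epsilon>(1)] \<epsilon> by (intro exI[of _ "4000 / \<epsilon> + 2"]) (auto intro!: sparse_risk_le)
    obtain a\<^sub>0 where a0: "a\<^sub>0 > 0"
      and small: "\<And>A. 0 < A \<Longrightarrow> A < a\<^sub>0 \<Longrightarrow> 2 * A \<le> 1 \<and> 1 - \<epsilon> \<le> 1 - sqrt (exp (2 * (2 * A)\<^sup>2) - 1)"
      using small_radius_exists[OF \<epsilon>] by blast
    have "ennreal (1 - \<epsilon>) \<le> testing_risk d \<sigma> 0 (real s) (A * sqrt (psi_sparse \<sigma> s d))"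
      if "1 \<le> s \<and> s \<le> d \<and> \<sigma> > 0" "0 < A" "A < a\<^sub>0" for s d \<sigma> A
    proof -
      have A: "2 * A \<le> 1" "1 - \<epsilon> \<le> 1 - sqrt (exp (2 * (2 * A)\<^sup>2) - 1)" using small[of A] that by auto
      show ?thesis
        by (rule order_trans[OF ennreal_leI[OF A(2)] sparse_risk_ge]) (use that A in auto)
    qed
    then show "\<exists>a\<^sub>0>0. \<forall>i\<in>{(s::nat, d::nat, \<sigma>::real). 1 \<le> s \<and> s \<le> d \<and> \<sigma> > 0}. \<forall>A. 0 < A \<and> A < a\<^sub>0 \<longrightarrow>
        (case i of (s, d, \<sigma>) \<Rightarrow> testing_risk d \<sigma> 0 (real s)) (A * (case i of (s, d, \<sigma>) \<Rightarrow> sqrt (psi_sparse \<sigma> s d)))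
          \<ge> ennreal (1 - \<epsilon>)"
      using a0 by (intro exI[of _ a\<^sub>0]) auto
  qed (auto simp: psi_sparse_pos)
  moreover have "minimax_testing_rate
      {(q::real, r::real, d::nat, \<sigma>::real). 0 < q \<and> q < 2 \<and> r > 0 \<and> 1 \<le> d \<and> \<sigma> > 0}
      (\<lambda>(q, r, d, \<sigma>). testing_risk d \<sigma> q r)
      (\<lambda>(q, r, d, \<sigma>). sqrt (psi_ball \<sigma> q r d))"
    unfolding minimax_testing_rate_def
  proof (intro conjI allI impI)
    fix \<epsilon> :: real assume "0 < \<epsilon> \<and> \<epsilon> < 1"
    then have \<epsilon>: "0 < \<epsilon>" "\<epsilon> < 1" by auto
    show "\<exists>A\<^sub>0>0. \<forall>i\<in>{(q::real, r::real, d::nat, \<sigma>::real). 0 < q \<and> q < 2 \<and> r > 0 \<and> 1 \<le> d \<and> \<sigma> > 0}. \<forall>A>A\<^sub>0.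
        (case i of (q, r, d, \<sigma>) \<Rightarrow> testing_risk d \<sigma> q r) (A * (case i of (q, r, d, \<sigma>) \<Rightarrow> sqrt (psi_ball \<sigma> q r d)))
          \<le> ennreal \<epsilon>"
      using large[OF \<epsilon>(1)] \<epsilon> by (intro exI[of _ "4000 / \<epsilon> + 2"]) (auto intro!: ball_risk_le)
    obtain a\<^sub>0 where a0: "a\<^sub>0 > 0"
      and small: "\<And>A. 0 < A \<Longrightarrow> A < a\<^sub>0 \<Longrightarrow> 2 * A \<le> 1 \<and> 1 - \<epsilon> \<le> 1 - sqrt (exp (2 * (2 * A)\<^sup>2) - 1)"
      using small_radius_exists[OF \<epsilon>] by blast
    have "ennreal (1 - \<epsilon>) \<le> testing_risk d \<sigma> q r (A * sqrt (psi_ball \<sigma> q r d))"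
      if "0 < q \<and> q < 2 \<and> r > 0 \<and> 1 \<le> d \<and> \<sigma> > 0" "0 < A" "A < a\<^sub>0" for q r d \<sigma> A
    proof -
      have A: "2 * A \<le> 1" "1 - \<epsilon> \<le> 1 - sqrt (exp (2 * (2 * A)\<^sup>2) - 1)" using small[of A] that by auto
      show ?thesis
        by (rule order_trans[OF ennreal_leI[OF A(2)] ball_risk_ge]) (use that A in auto)
    qed
    then show "\<exists>a\<^sub>0>0. \<forall>i\<in>{(q::real, r::real, d::nat, \<sigma>::real). 0 < q \<and> q < 2 \<and> r > 0 \<and> 1 \<le> d \<and> \<sigma> > 0}. \<forall>A. 0 < A \<and> A < a\<^sub>0 \<longrightarrow>
        (case i of (q, r, d, \<sigma>) \<Rightarrow> testing_risk d \<sigma> q r) (A * (case i of (q, r, d, \<sigma>) \<Rightarrow> sqrt (psi_ball \<sigma> q r d)))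
          \<ge> ennreal (1 - \<epsilon>)"
      using a0 by (intro exI[of _ a\<^sub>0]) auto
  qed (auto simp: psi_ball_pos)
  ultimately show ?thesis ..
qed

end
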